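(* Let $(M_{*}(\mathbf{C}),\Delta_{\varphi})$ be the C$^{*}$-bialgebra where $M_{*}(\mathbf{C})=\bigoplus_{n\geq 1}M_{n}(\mathbf{C})$ (C$^{*}$-direct sum) and $\Delta_{\varphi}$ is the comultiplication given, for $x\in M_{n}(\mathbf{C})$, by $\Delta_{\varphi}(x)=\sum_{m,l:\,ml=n}\varphi_{m,l}(x)$, where $\varphi_{n,m}:M_{nm}(\mathbf{C})\to M_{n}(\mathbf{C})\otimes M_{m}(\mathbf{C})$ is the $*$-homomorphism determined by $$\varphi_{n,m}\bigl(E^{(nm)}_{m(i-1)+j,\,m(i'-1)+j'}\bigr)=E^{(n)}_{i,i'}\otimes E^{(m)}_{j,j'}\qquad(i,i'\in\{1,\dots,n\},\ j,j'\in\{1,\dots,m\}).$$ For $n,m\geq 1$ let $R^{(n,m)}\in M_{n}(\mathbf{C})\otimes M_{m}(\mathbf{C})\cong \mathrm{End}_{\mathbf{C}}(\mathbf{C}^{n}\otimes\mathbf{C}^{m})$ be the unitary defined by $$R^{(n,m)}(e^{(n)}_{i}\otimes e^{(m)}_{j})=e^{(n)}_{\underline{i}}\otimes e^{(m)}_{\underline{j}}\qquad ((i,j)\in\{1,\dots,n\}\times\{1,\dots,m\}),$$ where $(\underline{i},\underline{j})\in\{1,\dots,n\}\times\{1,\dots,m\}$ is the unique pair satisfying $m(i-1)+j=n(\underline{j}-1)+\underline{i}$. Let $$R=(R^{(n,m)})_{n,m\geq 1}\in\prod_{n,m\geq 1}M_{n}(\mathbf{C})\otimes M_{m}(\mathbf{C})=\mathcal{M}(M_{*}(\mathbf{C})\otimes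 M_{*}(\mathbf{C})).$$ Then: (i) The unitary $R$ is a universal $R$-matrix of $(M_{*}(\mathbf{C}),\Delta_{\varphi})$. (ii) In addition to (i), the quasi-cocommutative C$^{*}$-bialgebra $(M_{*}(\mathbf{C}),\Delta_{\varphi},R)$ is triangular.
   Context: Notation: $M_{n}(\mathbf{C})$ is the C$^{*}$-algebra of $n\times n$ complex matrices ($M_{1}(\mathbf{C})=\mathbf{C}$), with standard matrix units $E^{(n)}_{i,j}$; $\{e^{(n)}_{i}\}_{i=1}^{n}$ is the standard basis of $\mathbf{C}^{n}$. The tensor product $\otimes$ of C$^{*}$-algebras is the minimal one. Direct sums and products: for C$^{*}$-algebras $\{A_{i}\}_{i\in\Omega}$, $\prod_{i}A_{i}=\{(a_{i}):\sup_{i}\|a_{i}\|<\infty\}$, and $\bigoplus_{i}A_{i}$ is the set of $(a_{i})$ with $\|a_{i}\|\to 0$, i.e. for every $\varepsilon>0$ only finitely many $i$ satisfy $\|a_{i}\|>\varepsilon$. Multiplier algebra: $\mathcal{M}(A)=\{a\in A'':aA\subset A,\ Aa\subset A\}$, where $A''$ is the enveloping von Neumann algebra of $A$. If every $A_{i}$ is unital, then $\mathcal{M}(\bigoplus_{i}A_{i})\cong\prod_{i}A_{i}$. A $*$-homomorphism $f:A\to\mathcal{M}(B)$ is nondegenerate if $f(A)B$ is dense in $B$; such an $f$ extends uniquely to a $*$-homomorphism $\mathcal{M}(A)\to\mathcal{M}(B)$, and the extension is denoted by the same symbol. C$^{*}$-bialgebra: a pair $(A,\Delta)$ where $A$ is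 a C$^{*}$-algebra and $\Delta:A\to\mathcal{M}(A\otimes A)$ is a nondegenerate $*$-homomorphism (the comultiplication) with $(\Delta\otimes id)\circ\Delta=(id\otimes\Delta)\circ\Delta$. It is known that $(M_{*}(\mathbf{C}),\Delta_{\varphi})$ is a C$^{*}$-bialgebra, with $\Delta_{\varphi}$ extended linearly and continuously from the summands. Flip and opposite comultiplication: $\tau_{A,A}$ is the flip of $A\otimes A$, and $\tilde{\tau}_{A,A}:\mathcal{M}(A\otimes A)\to\mathcal{M}(A\otimes A)$ is its extension, $\tilde{\tau}_{A,A}(X)(x\otimes y)=\tau_{A,A}(X(y\otimes x))$ for $X\in\mathcal{M}(A\otimes A)$, $x,y\in A$. Put $\Delta^{op}(x)=\tilde{\tau}_{A,A}(\Delta(x))$. Universal $R$-matrix: a unitary $R\in\mathcal{M}(A\otimes A)$ such that $R\Delta(x)R^{*}=\Delta^{op}(x)$ for all $x\in A$. If one exists, $(A,\Delta)$ is called quasi-cocommutative, written $(A,\Delta,R)$. A quasi-cocommutative C$^{*}$-bialgebra $(A,\Delta,R)$ is quasi-triangular if $$(\Delta\otimes id)(R)=R_{13}R_{23},\qquad (id\otimes\Delta)(R)=R_{13}R_{12}$$ in $\mathcal{M}(A\otimes A\otimes A)$ (leg numbering notation: $R_{ij}$ acts as $R$ in the $i$-th and $j$-th tensor factors and as the identity in the remaining one; $\Delta\otimes id$ and $id\otimes\Delta$ denote their extensions to $\mathcal{M}(A\otimes A)$). It is triangular if it is quasi-triangular and $R\,\tilde{\tau}_{A,A}(R)=I$,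 where $I$ is the unit of $\mathcal{M}(A\otimes A)$. *)

theory Defs
  imports "HOL-Analysis.Analysis"
begin

section \<open>Bounded operators on \<open>\<ell>\<^sup>2\<close>\<close>

text \<open>
  An operator on the Hilbert space with orthonormal basis indexed by the type \<open>'i\<close> is represented
  by its matrix.  A matrix belongs to a bounded operator of norm at most \<open>C\<close> iff its
  sesquilinear form is bounded by \<open>C\<close> on finitely supported vectors; for such matrices the series
  defining the product below converge absolutely.
\<close>

type_synonym 'i oper = "'i \<Rightarrow> 'i \<Rightarrow> complex"

definition op_bound :: "'i oper \<Rightarrow> real \<Rightarrow> bool" where
  "op_bound T C \<longleftrightarrow> 0 \<le> C \<and> (\<forall>F v w. finite F \<longrightarrow>
     cmod (\<Sum>i\<in>F. \<Sum>j\<in>F. cnj (w i) * T i j * v j)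
       \<le> C * L2_set (\<lambda>i. cmod (v i)) F * L2_set (\<lambda>i. cmod (w i)) F)"

definition bounded_op :: "'i oper \<Rightarrow> bool" where
  "bounded_op T \<longleftrightarrow> (\<exists>C. op_bound T C)"

definition opnorm :: "'i oper \<Rightarrow> real" where
  "opnorm T = Inf {C. op_bound T C}"

definition op_zero :: "'i oper" where
  "op_zero = (\<lambda>i j. 0)"

definition op_one :: "'i oper" where
  "op_one = (\<lambda>i j. if i = j then 1 else 0)"

definition op_add :: "'i oper \<Rightarrow> 'i oper \<Rightarrow> 'i oper"  (infixl "\<oplus>\<^sub>o" 65) where
  "S \<oplus>\<^sub>o T = (\<lambda>i j. S i j + T i j)"

definition op_diff :: "'i oper \<Rightarrow> 'i oper \<Rightarrow> 'i oper"  (infixl "\<ominus>\<^sub>o" 65) where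
  "S \<ominus>\<^sub>o T = (\<lambda>i j. S i j - T i j)"

definition op_scale :: "complex \<Rightarrow> 'i oper \<Rightarrow> 'i oper" where
  "op_scale c T = (\<lambda>i j. c * T i j)"

definition op_mult :: "'i oper \<Rightarrow> 'i oper \<Rightarrow> 'i oper"  (infixl "\<odot>\<^sub>o" 70) where
  "S \<odot>\<^sub>o T = (\<lambda>i j. \<Sum>\<^sub>\<infinity>k. S i k * T k j)"

definition adj :: "'i oper \<Rightarrow> 'i oper" where
  "adj T = (\<lambda>i j. cnj (T j i))"

definition op_tensor :: "'i oper \<Rightarrow> 'j oper \<Rightarrow> ('i \<times> 'j) oper"  (infixl "\<otimes>\<^sub>o" 75) where
  "S \<otimes>\<^sub>o T = (\<lambda>(i, k) (j, l). S i j * T k l)"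

definition cspan :: "'i oper set \<Rightarrow> 'i oper set" where
  "cspan S = {T. \<exists>F c. finite F \<and> F \<subseteq> S \<and> T = (\<lambda>i j. \<Sum>s\<in>F. c s * s i j)}"

definition norm_closure :: "'i oper set \<Rightarrow> 'i oper set" where
  "norm_closure S = {T. bounded_op T \<and> (\<forall>\<epsilon>>0. \<exists>s\<in>S. opnorm (T \<ominus>\<^sub>o s) < \<epsilon>)}"


section \<open>C*-algebras, tensor products and multipliers\<close>

text \<open>
  C*-algebras are taken in a faithful nondegenerate representation: norm-closed *-subalgebras of the
  bounded operators such that no nonzero vector is annihilated by the whole algebra.
\<close>

definition cstar_algebra :: "'i oper set \<Rightarrow> bool" where
  "cstar_algebra A \<longleftrightarrow>
     (\<forall>a\<in>A. bounded_op a) \<and>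
     op_zero \<in> A \<and>
     (\<forall>a\<in>A. \<forall>b\<in>A. a \<oplus>\<^sub>o b \<in> A) \<and>
     (\<forall>c. \<forall>a\<in>A. op_scale c a \<in> A) \<and>
     (\<forall>a\<in>A. \<forall>b\<in>A. a \<odot>\<^sub>o b \<in> A) \<and>
     (\<forall>a\<in>A. adj a \<in> A) \<and>
     norm_closure A \<subseteq> A \<and>
     (\<forall>v. (\<lambda>j. (cmod (v j))\<^sup>2) summable_on UNIV \<longrightarrow>
          (\<forall>a\<in>A. \<forall>i. (\<Sum>\<^sub>\<infinity>j. a i j * v j) = 0) \<longrightarrow> v = (\<lambda>j. 0))"

text \<open>The minimal (spatial) tensor product.\<close>

definition alg_tensor :: "'i oper set \<Rightarrow> 'j oper set \<Rightarrow> ('i \<times> 'j) oper set"  (infixr "\<otimes>\<^sub>m" 75) where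
  "A \<otimes>\<^sub>m B = norm_closure (cspan {a \<otimes>\<^sub>o b | a b. a \<in> A \<and> b \<in> B})"

definition commutant :: "'i oper set \<Rightarrow> 'i oper set" where
  "commutant S = {T. bounded_op T \<and> (\<forall>s\<in>S. T \<odot>\<^sub>o s = s \<odot>\<^sub>o T)}"

text \<open>
  The multiplier algebra, with the bicommutant of \<open>A\<close> in the given representation in the role of the
  enveloping von Neumann algebra.  For a faithful nondegenerate representation the resulting algebra
  is canonically isomorphic to the one formed inside the enveloping von Neumann algebra.  For a
  C*-direct sum of full matrix algebras acting on the sum of the underlying spaces, the bicommutant
  itself is the enveloping von Neumann algebra.
\<close>

definition multipliers :: "'i oper set \<Rightarrow> 'i oper set" where
  "multipliers A =
     {x \<in> commutant (commutant A). \<forall>a\<in>A. x \<odot>\<^sub>o a \<in> A \<and> a \<odot>\<^sub>o x \<in> A}"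

definition star_hom :: "'i oper set \<Rightarrow> 'j oper set \<Rightarrow> ('i oper \<Rightarrow> 'j oper) \<Rightarrow> bool" where
  "star_hom A B f \<longleftrightarrow>
     (\<forall>a\<in>A. f a \<in> B) \<and>
     (\<forall>a\<in>A. \<forall>b\<in>A. f (a \<oplus>\<^sub>o b) = f a \<oplus>\<^sub>o f b) \<and>
     (\<forall>c. \<forall>a\<in>A. f (op_scale c a) = op_scale c (f a)) \<and>
     (\<forall>a\<in>A. \<forall>b\<in>A. f (a \<odot>\<^sub>o b) = f a \<odot>\<^sub>o f b) \<and>
     (\<forall>a\<in>A. f (adj a) = adj (f a))"

definition nondegenerate_hom :: "'i oper set \<Rightarrow> 'j oper set \<Rightarrow> ('i oper \<Rightarrow> 'j oper) \<Rightarrow> bool" where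
  "nondegenerate_hom A B f \<longleftrightarrow>
     star_hom A (multipliers B) f \<and>
     B \<subseteq> norm_closure (cspan {f a \<odot>\<^sub>o b | a b. a \<in> A \<and> b \<in> B})"

text \<open>The extension of a nondegenerate \<open>f : A \<rightarrow> M(B)\<close> to a *-homomorphism \<open>M(A) \<rightarrow> M(B)\<close>.\<close>

definition mult_ext ::
  "'i oper set \<Rightarrow> 'j oper set \<Rightarrow> ('i oper \<Rightarrow> 'j oper) \<Rightarrow> 'i oper \<Rightarrow> 'j oper" where
  "mult_ext A B f =
     (THE g. g \<in> extensional (multipliers A) \<and>
             star_hom (multipliers A) (multipliers B) g \<and>
             (\<forall>a\<in>A. g a = f a))"

text \<open>For \<open>f : A \<rightarrow> M(B)\<close> and \<open>h : C \<rightarrow> M(D)\<close>, the *-homomorphism \<open>f \<otimes> h : A \<otimes> C \<rightarrow> M(B \<otimes> D)\<close>.\<close>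

definition hom_tensor ::
  "'i oper set \<Rightarrow> 'k oper set \<Rightarrow> 'j oper set \<Rightarrow> 'l oper set \<Rightarrow>
   ('i oper \<Rightarrow> 'j oper) \<Rightarrow> ('k oper \<Rightarrow> 'l oper) \<Rightarrow> ('i \<times> 'k) oper \<Rightarrow> ('j \<times> 'l) oper" where
  "hom_tensor A C B D f h =
     (THE g. g \<in> extensional (A \<otimes>\<^sub>m C) \<and>
             star_hom (A \<otimes>\<^sub>m C) (multipliers (B \<otimes>\<^sub>m D)) g \<and>
             (\<forall>a\<in>A. \<forall>c\<in>C. g (a \<otimes>\<^sub>o c) = f a \<otimes>\<^sub>o h c))"


section \<open>C*-bialgebras and R-matrices\<close>

text \<open>The identification of operators on \<open>(H \<otimes> K) \<otimes> L\<close> with operators on \<open>H \<otimes> (K \<otimes> L)\<close>.\<close>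

definition reassoc :: "(('i \<times> 'j) \<times> 'k) oper \<Rightarrow> ('i \<times> 'j \<times> 'k) oper" where
  "reassoc T = (\<lambda>(i, j, k) (i', j', k'). T ((i, j), k) ((i', j'), k'))"

text \<open>The extensions of \<open>\<Delta> \<otimes> id\<close> and \<open>id \<otimes> \<Delta>\<close> to \<open>M(A \<otimes> A)\<close>, with values in \<open>M(A \<otimes> (A \<otimes> A))\<close>.\<close>

definition comult_id ::
  "'i oper set \<Rightarrow> ('i oper \<Rightarrow> ('i \<times> 'i) oper) \<Rightarrow> ('i \<times> 'i) oper \<Rightarrow> ('i \<times> 'i \<times> 'i) oper" where
  "comult_id A \<Delta> X =
     reassoc (mult_ext (A \<otimes>\<^sub>m A) ((A \<otimes>\<^sub>m A) \<otimes>\<^sub>m A) (hom_tensor A A (A \<otimes>\<^sub>m A) A \<Delta> (\<lambda>a. a)) X)"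

definition id_comult ::
  "'i oper set \<Rightarrow> ('i oper \<Rightarrow> ('i \<times> 'i) oper) \<Rightarrow> ('i \<times> 'i) oper \<Rightarrow> ('i \<times> 'i \<times> 'i) oper" where
  "id_comult A \<Delta> X =
     mult_ext (A \<otimes>\<^sub>m A) (A \<otimes>\<^sub>m (A \<otimes>\<^sub>m A)) (hom_tensor A A A (A \<otimes>\<^sub>m A) (\<lambda>a. a) \<Delta>) X"

definition cstar_bialgebra :: "'i oper set \<Rightarrow> ('i oper \<Rightarrow> ('i \<times> 'i) oper) \<Rightarrow> bool" where
  "cstar_bialgebra A \<Delta> \<longleftrightarrow>
     cstar_algebra A \<and>
     nondegenerate_hom A (A \<otimes>\<^sub>m A) \<Delta> \<and>
     (\<forall>x\<in>A. comult_id A \<Delta> (\<Delta> x) = id_comult A \<Delta> (\<Delta> x))"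

text \<open>
  Conjugation by the flip unitary; it restricts to the flip of \<open>A \<otimes> A\<close>, and \<open>op_flip_mult\<close> below is
  the equation characterising its extension to \<open>M(A \<otimes> A)\<close>.
\<close>

definition op_flip :: "('i \<times> 'i) oper \<Rightarrow> ('i \<times> 'i) oper" where
  "op_flip X = (\<lambda>(i, j) (i', j'). X (j, i) (j', i'))"

lemma op_flip_tensor: "op_flip (x \<otimes>\<^sub>o y) = y \<otimes>\<^sub>o x"
  by (auto simp: op_flip_def op_tensor_def fun_eq_iff)

lemma op_flip_mult: "op_flip X \<odot>\<^sub>o (x \<otimes>\<^sub>o y) = op_flip (X \<odot>\<^sub>o (y \<otimes>\<^sub>o x))"
proof (intro ext, clarify)
  fix i j i' j'
  have "(\<Sum>\<^sub>\<infinity>k. X (j, i) k * (y \<otimes>\<^sub>o x) k (j', i')) =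
        (\<Sum>\<^sub>\<infinity>k. X (j, i) (prod.swap k) * (y \<otimes>\<^sub>o x) (prod.swap k) (j', i'))"
    by (rule infsum_reindex_bij_betw[symmetric]) (rule bij_swap)
  also have "\<dots> = (\<Sum>\<^sub>\<infinity>k. op_flip X (i, j) k * (x \<otimes>\<^sub>o y) k (i', j'))"
    by (intro infsum_cong) (auto simp: op_flip_def op_tensor_def)
  finally show "(op_flip X \<odot>\<^sub>o (x \<otimes>\<^sub>o y)) (i, j) (i', j') = op_flip (X \<odot>\<^sub>o (y \<otimes>\<^sub>o x)) (i, j) (i', j')"
    by (simp add: op_mult_def op_flip_def)
qed

definition unitary_op :: "'i oper \<Rightarrow> bool" where
  "unitary_op U \<longleftrightarrow> U \<odot>\<^sub>o adj U = op_one \<and> adj U \<odot>\<^sub>o U = op_one"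

definition universal_R_matrix ::
  "'i oper set \<Rightarrow> ('i oper \<Rightarrow> ('i \<times> 'i) oper) \<Rightarrow> ('i \<times> 'i) oper \<Rightarrow> bool" where
  "universal_R_matrix A \<Delta> R \<longleftrightarrow>
     R \<in> multipliers (A \<otimes>\<^sub>m A) \<and> unitary_op R \<and>
     (\<forall>x\<in>A. R \<odot>\<^sub>o \<Delta> x \<odot>\<^sub>o adj R = op_flip (\<Delta> x))"

definition quasi_cocommutative ::
  "'i oper set \<Rightarrow> ('i oper \<Rightarrow> ('i \<times> 'i) oper) \<Rightarrow> ('i \<times> 'i) oper \<Rightarrow> bool" where
  "quasi_cocommutative A \<Delta> R \<longleftrightarrow> cstar_bialgebra A \<Delta> \<and> universal_R_matrix A \<Delta> R"

definition leg12 :: "('i \<times> 'i) oper \<Rightarrow> ('i \<times> 'i \<times> 'i) oper" where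
  "leg12 X = (\<lambda>(i, j, k) (i', j', k'). X (i, j) (i', j') * op_one k k')"

definition leg13 :: "('i \<times> 'i) oper \<Rightarrow> ('i \<times> 'i \<times> 'i) oper" where
  "leg13 X = (\<lambda>(i, j, k) (i', j', k'). X (i, k) (i', k') * op_one j j')"

definition leg23 :: "('i \<times> 'i) oper \<Rightarrow> ('i \<times> 'i \<times> 'i) oper" where
  "leg23 X = (\<lambda>(i, j, k) (i', j', k'). X (j, k) (j', k') * op_one i i')"

definition quasi_triangular ::
  "'i oper set \<Rightarrow> ('i oper \<Rightarrow> ('i \<times> 'i) oper) \<Rightarrow> ('i \<times> 'i) oper \<Rightarrow> bool" where
  "quasi_triangular A \<Delta> R \<longleftrightarrow>
     quasi_cocommutative A \<Delta> R \<and>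
     comult_id A \<Delta> R = leg13 R \<odot>\<^sub>o leg23 R \<and>
     id_comult A \<Delta> R = leg13 R \<odot>\<^sub>o leg12 R"

definition triangular ::
  "'i oper set \<Rightarrow> ('i oper \<Rightarrow> ('i \<times> 'i) oper) \<Rightarrow> ('i \<times> 'i) oper \<Rightarrow> bool" where
  "triangular A \<Delta> R \<longleftrightarrow> quasi_triangular A \<Delta> R \<and> R \<odot>\<^sub>o op_flip R = op_one"


section \<open>The direct sum of all matrix algebras\<close>

text \<open>
  The C*-direct sum of the algebras of \<open>n \<times> n\<close> matrices (\<open>n \<ge> 1\<close>) acts on the Hilbert space
  \<open>\<Oplus>\<^sub>n \<complex>\<^sup>n\<close>, whose standard basis vectors \<open>e\<^sup>(\<^sup>n\<^sup>)\<^sub>i\<close> are indexed by the following type.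
\<close>

typedef bidx = "{(n :: nat, i :: nat). 1 \<le> i \<and> i \<le> n}"
  by (rule exI[of _ "(1, 1)"]) simp

definition blk :: "bidx \<Rightarrow> nat" where
  "blk p = fst (Rep_bidx p)"

definition pos :: "bidx \<Rightarrow> nat" where
  "pos p = snd (Rep_bidx p)"

definition bix :: "nat \<Rightarrow> nat \<Rightarrow> bidx" where
  "bix n i = Abs_bidx (n, i)"

lemma pos_bounds: "1 \<le> pos p" "pos p \<le> blk p"
  using Rep_bidx[of p] by (auto simp: blk_def pos_def)

lemma bix_blk_pos [simp]: "bix (blk p) (pos p) = p"
  by (simp add: bix_def blk_def pos_def Rep_bidx_inverse)

lemma blk_bix [simp]: "1 \<le> i \<Longrightarrow> i \<le> n \<Longrightarrow> blk (bix n i) = n"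
  and pos_bix [simp]: "1 \<le> i \<Longrightarrow> i \<le> n \<Longrightarrow> pos (bix n i) = i"
  by (simp_all add: bix_def blk_def pos_def Abs_bidx_inverse)

lemma bidx_eq_iff: "p = q \<longleftrightarrow> blk p = blk q \<and> pos p = pos q"
  by (metis bix_blk_pos)

definition block :: "nat \<Rightarrow> bidx oper \<Rightarrow> bidx oper" where
  "block n T = (\<lambda>p q. if blk p = n \<and> blk q = n then T p q else 0)"

definition Mstar :: "bidx oper set" where
  "Mstar = {T. bounded_op T \<and>
               (\<forall>p q. blk p \<noteq> blk q \<longrightarrow> T p q = 0) \<and>
               (\<forall>\<epsilon>>0. finite {n. opnorm (block n T) > \<epsilon>})}"

definition matrix_unit :: "nat \<Rightarrow> nat \<Rightarrow> nat \<Rightarrow> bidx oper" where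
  "matrix_unit n i i' = (\<lambda>p q. if p = bix n i \<and> q = bix n i' then 1 else 0)"

text \<open>
  \<open>phi n m x\<close> is \<open>\<phi>\<^bsub>n,m\<^esub>\<close> applied to the component of \<open>x\<close> in the summand of size \<open>n * m\<close>, as an
  operator that vanishes outside \<open>\<complex>\<^sup>n \<otimes> \<complex>\<^sup>m\<close>; see \<open>phi_matrix_unit\<close>.
\<close>

definition phi :: "nat \<Rightarrow> nat \<Rightarrow> bidx oper \<Rightarrow> (bidx \<times> bidx) oper" where
  "phi n m x = (\<lambda>(p, q) (p', q').
     if blk p = n \<and> blk q = m \<and> blk p' = n \<and> blk q' = m
     then x (bix (n * m) (m * (pos p - 1) + pos q)) (bix (n * m) (m * (pos p' - 1) + pos q'))
     else 0)"

text \<open>The comultiplication: its component in the summand \<open>(n, m)\<close> is \<open>\<phi>\<^bsub>n,m\<^esub>(x\<^bsub>n m\<^esub>)\<close>.  This is the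
  linear and continuous extension of the finite sums in \<open>Delta_phi_summand\<close>.\<close>

definition Delta_phi :: "bidx oper \<Rightarrow> (bidx \<times> bidx) oper" where
  "Delta_phi x = (\<lambda>(p, q) (p', q'). phi (blk p) (blk q) x (p, q) (p', q'))"

text \<open>The positions of the basis vector to which \<open>R\<^sup>(\<^sup>n\<^sup>,\<^sup>m\<^sup>)\<close> maps the one with positions \<open>(i, j)\<close>; see
  \<open>under_pair_unique\<close>.\<close>

definition under_pair :: "nat \<Rightarrow> nat \<Rightarrow> nat \<Rightarrow> nat \<Rightarrow> nat \<times> nat" where
  "under_pair n m i j =
     (THE (a, b). a \<in> {1..n} \<and> b \<in> {1..m} \<and> m * (i - 1) + j = n * (b - 1) + a)"

text \<open>The operator \<open>R\<close>; columns are indexed by the primed variables, so it maps the basis vector at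
  \<open>(p', q')\<close> to the one at \<open>(p, q)\<close> with positions \<open>under_pair\<close> in the same summand.\<close>

definition R_op :: "(bidx \<times> bidx) oper" where
  "R_op = (\<lambda>(p, q) (p', q').
     if blk p = blk p' \<and> blk q = blk q' \<and>
        (pos p, pos q) = under_pair (blk p') (blk q') (pos p') (pos q')
     then 1 else 0)"

lemma digits_le:
  fixes n m i j :: nat
  assumes "1 \<le> i" "i \<le> n" "1 \<le> j" "j \<le> m"
  shows "1 \<le> m * (i - 1) + j" "m * (i - 1) + j \<le> n * m"
proof -
  show "1 \<le> m * (i - 1) + j" using assms by simp
  have "m * (i - 1) + j \<le> m * (i - 1) + m * 1" using assms by simp
  also have "\<dots> = m * i" using assms by (cases i) auto
  also have "\<dots> \<le> n * m" using assms by (simp add: mult.commute)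
  finally show "m * (i - 1) + j \<le> n * m" .
qed

lemma digits_eq_iff:
  fixes m i j i' j' :: nat
  assumes "1 \<le> i" "1 \<le> i'" "1 \<le> j" "j \<le> m" "1 \<le> j'" "j' \<le> m"
  shows "m * (i - 1) + j = m * (i' - 1) + j' \<longleftrightarrow> i = i' \<and> j = j'"
proof
  assume eq: "m * (i - 1) + j = m * (i' - 1) + j'"
  define a b a' b' where "a = i - 1" and "b = j - 1" and "a' = i' - 1" and "b' = j' - 1"
  note d = this
  have lt: "b < m" "b' < m" using assms by (auto simp: d)
  have eq': "b + m * a = b' + m * a'"
    using eq assms unfolding d by linarith
  have "(b + m * a) div m = a" "(b' + m * a') div m = a'" using lt by simp_all
  with eq' have "a = a'" by simp
  then have "i = i'" using assms by (simp add: d)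
  with eq show "i = i' \<and> j = j'" by simp
qed simp

lemma phi_matrix_unit:
  fixes n m i j i' j' :: nat
  assumes "i \<in> {1..n}" "i' \<in> {1..n}" "j \<in> {1..m}" "j' \<in> {1..m}"
  shows "phi n m (matrix_unit (n * m) (m * (i - 1) + j) (m * (i' - 1) + j')) =
         matrix_unit n i i' \<otimes>\<^sub>o matrix_unit m j j'"
proof -
  have aux: "(blk p = n \<and> blk q = m \<and>
         bix (n * m) (m * (pos p - 1) + pos q) = bix (n * m) (m * (k - 1) + l)) \<longleftrightarrow>
        (p = bix n k \<and> q = bix m l)"
    if "k \<in> {1..n}" "l \<in> {1..m}" for p q k l
  proof (cases "blk p = n \<and> blk q = m")
    case True
    then show ?thesis
      using that pos_bounds[of p] pos_bounds[of q]
        digits_le[of "pos p" n "pos q" m] digits_le[of k n l m]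
        digits_eq_iff[of "pos p" k "pos q" m l]
      by (auto simp: bidx_eq_iff)
  next
    case False
    then show ?thesis using that by auto
  qed
  show ?thesis
  proof (intro ext, clarify)
    fix p q p' q'
    show "phi n m (matrix_unit (n * m) (m * (i - 1) + j) (m * (i' - 1) + j')) (p, q) (p', q') =
          (matrix_unit n i i' \<otimes>\<^sub>o matrix_unit m j j') (p, q) (p', q')"
      using aux[of i j p q] aux[of i' j' p' q'] assms
      unfolding phi_def matrix_unit_def op_tensor_def by (auto split: if_splits)
  qed
qed

text \<open>On the summand of size \<open>n\<close> the comultiplication is the finite sum of the \<open>\<phi>\<^bsub>m,l\<^esub>\<close> with \<open>m l = n\<close>.\<close>

lemma Delta_phi_summand:
  assumes "n \<ge> 1" and "block n x = x"
  shows "Delta_phi x = (\<lambda>r s. \<Sum>(m, l) | m * l = n. phi m l x r s)"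
proof (intro ext, clarify)
  fix p q p' q'
  let ?g = "\<lambda>(m, l). phi m l x (p, q) (p', q')"
  have fin: "finite {(m, l). m * l = n}"
    by (rule finite_subset[of _ "{..n} \<times> {..n}"]) (use assms(1) in \<open>auto simp: dvd_imp_le\<close>)
  have zero: "phi m l x (p, q) (p', q') = 0" if "m * l \<noteq> n" for m l
  proof (cases "blk p = m \<and> blk q = l \<and> blk p' = m \<and> blk q' = l")
    case True
    have "blk (bix (m * l) (l * (pos p - 1) + pos q)) = m * l"
      using True pos_bounds[of p] pos_bounds[of q] digits_le[of "pos p" m "pos q" l] by simp
    then have "block n x (bix (m * l) (l * (pos p - 1) + pos q))
        (bix (m * l) (l * (pos p' - 1) + pos q')) = 0"
      using that by (simp add: block_def)
    then show ?thesis using assms(2) by (simp add: phi_def)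
  qed (auto simp: phi_def)
  have "(\<Sum>(m, l) | m * l = n. phi m l x (p, q) (p', q')) =
        (\<Sum>a\<in>{(m, l). m * l = n}. if a = (blk p, blk q) then ?g a else 0)"
    by (intro sum.cong refl) (simp add: phi_def split: prod.splits if_splits)
  also have "\<dots> = phi (blk p) (blk q) x (p, q) (p', q')"
    using fin zero[of "blk p" "blk q"] by auto
  finally show "Delta_phi x (p, q) (p', q') =
      (\<Sum>(m, l) | m * l = n. phi m l x (p, q) (p', q'))"
    by (simp add: Delta_phi_def)
qed

lemma under_pair_unique:
  fixes n m i j :: nat
  assumes "i \<in> {1..n}" "j \<in> {1..m}"
  shows "\<exists>!(a, b). a \<in> {1..n} \<and> b \<in> {1..m} \<and> m * (i - 1) + j = n * (b - 1) + a"
proof -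
  define k where "k = m * (i - 1) + j - 1"
  have k: "m * (i - 1) + j = k + 1" and kn: "k < m * n"
    using assms digits_le[of i n j m] by (auto simp: k_def mult.commute)
  have n0: "n > 0" using assms by auto
  have "k div n < m" using kn n0 by (simp add: less_mult_imp_div_less)
  moreover have "k mod n < n" using n0 by simp
  moreover have "n * (k div n) + k mod n = k" by simp
  ultimately have ex: "k mod n + 1 \<in> {1..n} \<and> k div n + 1 \<in> {1..m} \<and>
      m * (i - 1) + j = n * (k div n + 1 - 1) + (k mod n + 1)"
    unfolding k by auto
  show ?thesis
  proof (rule ex1I[of _ "(k mod n + 1, k div n + 1)"])
    show "case (k mod n + 1, k div n + 1) of (a, b) \<Rightarrow>
        a \<in> {1..n} \<and> b \<in> {1..m} \<and> m * (i - 1) + j = n * (b - 1) + a"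
      using ex by simp
  next
    fix ab :: "nat \<times> nat"
    assume "case ab of (a, b) \<Rightarrow> a \<in> {1..n} \<and> b \<in> {1..m} \<and> m * (i - 1) + j = n * (b - 1) + a"
    then obtain a b where ab: "ab = (a, b)" "a \<in> {1..n}" "b \<in> {1..m}"
      "m * (i - 1) + j = n * (b - 1) + a" by (cases ab) auto
    then show "ab = (k mod n + 1, k div n + 1)"
      using ex digits_eq_iff[of b "k div n + 1" a n "k mod n + 1"] by auto
  qed
qed

end

theory Submission
  imports Defs
begin

text \<open>
  The basis vectors of \<open>\<Oplus>\<^sub>n \<complex>\<^sup>n\<close> carry a product \<open>bmul\<close>: the vectors at position \<open>i\<close> of \<open>\<complex>\<^sup>n\<close> and
  position \<open>j\<close> of \<open>\<complex>\<^sup>m\<close> go to the one at position \<open>m (i - 1) + j\<close> of \<open>\<complex>\<^sup>n\<^sup>m\<close>.  Everything in the theorem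
  is governed by two properties of this product: it is associative (\<open>bmul_assoc\<close>), and a basis vector
  of \<open>\<complex>\<^sup>n\<^sup>m\<close> factors in exactly one way with factors in \<open>\<complex>\<^sup>n\<close> and \<open>\<complex>\<^sup>m\<close> (\<open>bmul_factor\<close>,
  \<open>bmul_cancel\<close>).  The comultiplication replaces each index of a matrix by its factorisation, so
  coassociativity is associativity of \<open>bmul\<close>.  The operator \<open>R\<close> is the permutation matrix of the
  relation \<open>bmul q p = bmul p' q'\<close> between \<open>(p, q)\<close> and \<open>(p', q')\<close>, taken within each block: it
  exchanges the factorisations of one vector in \<open>\<complex>\<^sup>n \<otimes> \<complex>\<^sup>m\<close> and \<open>\<complex>\<^sup>m \<otimes> \<complex>\<^sup>n\<close>.  Hence \<open>R\<close> intertwines the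
  comultiplication with its opposite, its flip is its adjoint, and the two equations of
  quasi-triangularity become statements about \<open>bmul\<close>: a three-fold product of basis vectors is
  reordered in one move or in two (\<open>hexagon_left\<close>, \<open>hexagon_right\<close>).
  
  To make this rigorous, the abstract constructions have to be computed.  All algebras that occur
  consist of operators that are block-diagonal for a map \<open>b\<close> from basis indices to block labels with
  finite fibres.  Those with block norms tending to zero form a C*-algebra \<open>C0 b\<close>, whose multiplier
  algebra is the algebra \<open>BD b\<close> of all bounded block-diagonal operators (\<open>multipliers_C0\<close>), and
  \<open>C0 b \<otimes>\<^sub>m C0 c\<close> is \<open>C0\<close> of the product structure (\<open>alg_tensor_C0\<close>).  A map of basis indices that is
  bijective from blocks to blocks induces a nondegenerate *-homomorphism \<open>pull\<close> by relabelling matrix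
  entries.  Such a homomorphism is determined by its values on matrix units
  (\<open>star_hom_determined\<close>): cutting an operator down to one block leaves a finite combination of matrix
  units, and multiplicativity recovers an operator from its cut-downs.  So
  the extension to multipliers and the tensor product of two such homomorphisms are again given by
  relabelling (\<open>mult_ext_pull\<close>, \<open>hom_tensor_pull\<close>).
\<close>

section \<open>Norm bounds of operators, block by block\<close>

definition vnorm :: "'i set \<Rightarrow> ('i \<Rightarrow> complex) \<Rightarrow> real" where
  "vnorm B v = L2_set (\<lambda>j. cmod (v j)) B"

definition op_app :: "'i set \<Rightarrow> 'i oper \<Rightarrow> ('i \<Rightarrow> complex) \<Rightarrow> 'i \<Rightarrow> complex" where
  "op_app B T v = (\<lambda>i. \<Sum>j\<in>B. T i j * v j)"

text \<open>
  A finite compression of an operator has norm at most \<open>C\<close>.  Stating this through the images of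
  vectors, and not through the sesquilinear form as in \<open>op_bound\<close>, makes bounds for products and
  tensor products immediate.
\<close>

definition local_bound :: "'i set \<Rightarrow> 'i oper \<Rightarrow> real \<Rightarrow> bool" where
  "local_bound B T C \<longleftrightarrow> (\<forall>v. vnorm B (op_app B T v) \<le> C * vnorm B v)"

lemma vnorm_nonneg [simp]: "0 \<le> vnorm B v"
  by (simp add: vnorm_def)

lemma vnorm_sq: "(vnorm B v)\<^sup>2 = (\<Sum>i\<in>B. (cmod (v i))\<^sup>2)"
  by (simp add: vnorm_def L2_set_def sum_nonneg)

lemma vnorm_cong: "(\<And>i. i \<in> B \<Longrightarrow> cmod (v i) = cmod (w i)) \<Longrightarrow> vnorm B v = vnorm B w"
  by (simp add: vnorm_def cong: L2_set_cong)

lemma vnorm_scale: "vnorm B (\<lambda>i. c * v i) = cmod c * vnorm B v"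
  by (simp add: vnorm_def norm_mult L2_set_right_distrib)

lemma vnorm_add: "vnorm B (\<lambda>i. v i + w i) \<le> vnorm B v + vnorm B w"
proof -
  have "vnorm B (\<lambda>i. v i + w i) \<le> L2_set (\<lambda>i. cmod (v i) + cmod (w i)) B"
    unfolding vnorm_def by (intro L2_set_mono) (auto simp: norm_triangle_ineq)
  also have "\<dots> \<le> vnorm B v + vnorm B w"
    unfolding vnorm_def by (rule L2_set_triangle_ineq)
  finally show ?thesis .
qed

lemma local_bound_mono: "local_bound B T C \<Longrightarrow> C \<le> D \<Longrightarrow> local_bound B T D"
  unfolding local_bound_def by (meson mult_right_mono order_trans vnorm_nonneg)

lemma local_bound_cong:
  "(\<And>i j. i \<in> B \<Longrightarrow> j \<in> B \<Longrightarrow> S i j = T i j) \<Longrightarrow> local_bound B S C \<longleftrightarrow> local_bound B T C"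
  unfolding local_bound_def op_app_def by (simp add: vnorm_def cong: L2_set_cong)

lemma local_bound_zero: "0 \<le> C \<Longrightarrow> local_bound B op_zero C"
  by (simp add: local_bound_def op_app_def op_zero_def vnorm_def L2_set_def sum_nonneg)

lemma local_bound_add:
  assumes "local_bound B S C" "local_bound B T D"
  shows "local_bound B (S \<oplus>\<^sub>o T) (C + D)"
  unfolding local_bound_def
proof
  fix v
  have "vnorm B (op_app B (S \<oplus>\<^sub>o T) v) = vnorm B (\<lambda>i. op_app B S v i + op_app B T v i)"
    by (simp add: op_app_def op_add_def sum.distrib algebra_simps)
  also have "\<dots> \<le> vnorm B (op_app B S v) + vnorm B (op_app B T v)"
    by (rule vnorm_add)
  also have "\<dots> \<le> C * vnorm B v + D * vnorm B v"
    using assms unfolding local_bound_def by (intro add_mono) auto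
  finally show "vnorm B (op_app B (S \<oplus>\<^sub>o T) v) \<le> (C + D) * vnorm B v"
    by (simp add: algebra_simps)
qed

lemma local_bound_scale:
  assumes "local_bound B T C"
  shows "local_bound B (op_scale c T) (cmod c * C)"
  unfolding local_bound_def
proof
  fix v
  have "op_app B (op_scale c T) v = (\<lambda>i. c * op_app B T v i)"
    by (simp add: op_app_def op_scale_def sum_distrib_left mult.assoc)
  then show "vnorm B (op_app B (op_scale c T) v) \<le> cmod c * C * vnorm B v"
    using assms by (simp add: vnorm_scale mult.assoc mult_left_mono local_bound_def)
qed

lemma local_bound_comp:
  assumes "local_bound B S C" "local_bound B T D" "0 \<le> C"
    and "\<And>i j. i \<in> B \<Longrightarrow> j \<in> B \<Longrightarrow> U i j = (\<Sum>k\<in>B. S i k * T k j)"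
  shows "local_bound B U (C * D)"
  unfolding local_bound_def
proof
  fix v
  have "op_app B U v i = op_app B S (op_app B T v) i" if "i \<in> B" for i
  proof -
    have "op_app B U v i = (\<Sum>j\<in>B. \<Sum>k\<in>B. S i k * T k j * v j)"
      using that assms(4) by (simp add: op_app_def sum_distrib_right)
    also have "\<dots> = (\<Sum>k\<in>B. \<Sum>j\<in>B. S i k * T k j * v j)"
      by (rule sum.swap)
    finally show ?thesis
      by (simp add: op_app_def sum_distrib_left mult.assoc)
  qed
  then have "vnorm B (op_app B U v) = vnorm B (op_app B S (op_app B T v))"
    by (intro vnorm_cong) simp
  also have "\<dots> \<le> C * vnorm B (op_app B T v)"
    using assms(1) by (simp add: local_bound_def)
  also have "\<dots> \<le> C * (D * vnorm B v)"
    using assms(2,3) by (intro mult_left_mono) (simp_all add: local_bound_def)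
  finally show "vnorm B (op_app B U v) \<le> C * D * vnorm B v"
    by (simp add: mult.assoc)
qed

lemma local_bound_reindex:
  assumes "bij_betw f B' B" "local_bound B T C"
    and U: "\<And>i j. i \<in> B' \<Longrightarrow> j \<in> B' \<Longrightarrow> U i j = T (f i) (f j)"
  shows "local_bound B' U C"
  unfolding local_bound_def
proof
  fix v
  define g where "g = inv_into B' f"
  have g: "g (f i) = i" if "i \<in> B'" for i
    using that assms(1) by (simp add: g_def bij_betw_def inv_into_f_f)
  have L: "L2_set h B = L2_set (\<lambda>i. h (f i)) B'" for h
    using assms(1) by (simp add: L2_set_def sum.reindex_bij_betw[OF assms(1), symmetric])
  have 1: "op_app B T (v \<circ> g) (f i) = op_app B' U v i" if "i \<in> B'" for i
    using that U g by (simp add: op_app_def sum.reindex_bij_betw[OF assms(1), symmetric] cong: sum.cong)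
  have "vnorm B' (op_app B' U v) = vnorm B (op_app B T (v \<circ> g))"
    unfolding vnorm_def L using 1 by (simp cong: L2_set_cong)
  also have "\<dots> \<le> C * vnorm B (v \<circ> g)"
    using assms(2) by (simp add: local_bound_def)
  also have "vnorm B (v \<circ> g) = vnorm B' v"
    unfolding vnorm_def L using g by (simp cong: L2_set_cong)
  finally show "vnorm B' (op_app B' U v) \<le> C * vnorm B' v" .
qed

text \<open>
  Factor \<open>S \<otimes> T\<close> as \<open>(S \<otimes> 1) (1 \<otimes> T)\<close>; each factor acts separately on the slices in one coordinate,
  so its bound follows by summing squares over the slices.
\<close>

lemma local_bound_tensor:
  assumes "local_bound B S C" "local_bound B' T D" "0 \<le> C" "0 \<le> D"
  shows "local_bound (B \<times> B') (S \<otimes>\<^sub>o T) (C * D)"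
  unfolding local_bound_def
proof
  fix v :: "'a \<times> 'b \<Rightarrow> complex"
  have sqb: "(vnorm A (op_app A X u))\<^sup>2 \<le> E\<^sup>2 * (vnorm A u)\<^sup>2" if "local_bound A X E" for A X E u
  proof -
    have "(vnorm A (op_app A X u))\<^sup>2 \<le> (E * vnorm A u)\<^sup>2"
      using that by (intro power_mono) (auto simp: local_bound_def)
    then show ?thesis by (simp add: power_mult_distrib)
  qed
  have vprod: "(vnorm (B \<times> B') u)\<^sup>2 = (\<Sum>i\<in>B. (vnorm B' (\<lambda>k. u (i, k)))\<^sup>2)" for u
    by (simp add: vnorm_sq sum.cartesian_product)
  have vprod': "(vnorm (B \<times> B') u)\<^sup>2 = (\<Sum>k\<in>B'. (vnorm B (\<lambda>i. u (i, k)))\<^sup>2)" for u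
    by (simp only: vprod) (simp only: vnorm_sq, rule sum.swap)
  define u where "u = (\<lambda>(j, k). op_app B' T (\<lambda>l. v (j, l)) k)"
  have app: "op_app (B \<times> B') (S \<otimes>\<^sub>o T) v (i, k) = op_app B S (\<lambda>j. u (j, k)) i" for i k
    by (simp add: sum.cartesian_product' op_app_def op_tensor_def u_def sum_distrib_left mult.assoc)
  have "(vnorm (B \<times> B') (op_app (B \<times> B') (S \<otimes>\<^sub>o T) v))\<^sup>2
      = (\<Sum>k\<in>B'. (vnorm B (op_app B S (\<lambda>j. u (j, k))))\<^sup>2)"
    by (simp add: vprod' app)
  also have "\<dots> \<le> (\<Sum>k\<in>B'. C\<^sup>2 * (vnorm B (\<lambda>j. u (j, k)))\<^sup>2)"
    by (intro sum_mono sqb assms)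
  also have "\<dots> = C\<^sup>2 * (vnorm (B \<times> B') u)\<^sup>2"
    by (simp add: vprod' sum_distrib_left)
  also have "\<dots> = C\<^sup>2 * (\<Sum>j\<in>B. (vnorm B' (op_app B' T (\<lambda>l. v (j, l))))\<^sup>2)"
    by (simp add: vprod u_def)
  also have "\<dots> \<le> C\<^sup>2 * (\<Sum>j\<in>B. D\<^sup>2 * (vnorm B' (\<lambda>l. v (j, l)))\<^sup>2)"
    by (intro mult_left_mono sum_mono sqb assms) simp
  also have "\<dots> = (C * D * vnorm (B \<times> B') v)\<^sup>2"
    by (simp add: vprod sum_distrib_left power_mult_distrib mult.assoc)
  finally show "vnorm (B \<times> B') (op_app (B \<times> B') (S \<otimes>\<^sub>o T) v) \<le> C * D * vnorm (B \<times> B') v"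
    by (rule power2_le_imp_le) (simp add: assms)
qed

text \<open>
  The form bound follows from the vector bound by Cauchy-Schwarz; conversely, take \<open>w = T v\<close> in the
  form and cancel one factor \<open>\<parallel>T v\<parallel>\<close>.
\<close>

lemma local_bound_iff_form:
  assumes "0 \<le> C"
  shows "local_bound B T C \<longleftrightarrow>
    (\<forall>v w. cmod (\<Sum>i\<in>B. \<Sum>j\<in>B. cnj (w i) * T i j * v j) \<le> C * vnorm B v * vnorm B w)"
proof -
  have form: "(\<Sum>i\<in>B. \<Sum>j\<in>B. cnj (w i) * T i j * v j) = (\<Sum>i\<in>B. cnj (w i) * op_app B T v i)"
    for v w by (simp add: op_app_def sum_distrib_left mult.assoc)
  show ?thesis
    unfolding form
  proof safe
    fix v w assume L: "local_bound B T C"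
    have "cmod (\<Sum>i\<in>B. cnj (w i) * op_app B T v i) \<le> (\<Sum>i\<in>B. cmod (w i) * cmod (op_app B T v i))"
      by (rule order_trans[OF norm_sum]) (simp add: norm_mult)
    also have "\<dots> \<le> vnorm B w * vnorm B (op_app B T v)"
      using L2_set_mult_ineq[of "\<lambda>i. cmod (w i)" "\<lambda>i. cmod (op_app B T v i)" B]
      by (simp add: vnorm_def)
    also have "\<dots> \<le> vnorm B w * (C * vnorm B v)"
      using L by (intro mult_left_mono) (simp_all add: local_bound_def)
    finally show "cmod (\<Sum>i\<in>B. cnj (w i) * op_app B T v i) \<le> C * vnorm B v * vnorm B w"
      by (simp add: mult_ac)
  next
    assume H: "\<forall>v w. cmod (\<Sum>i\<in>B. cnj (w i) * op_app B T v i) \<le> C * vnorm B v * vnorm B w"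
    show "local_bound B T C"
      unfolding local_bound_def
    proof
      fix v
      let ?n = "vnorm B (op_app B T v)"
      have "(\<Sum>i\<in>B. cnj (op_app B T v i) * op_app B T v i) = of_real (?n\<^sup>2)"
        unfolding vnorm_sq of_real_sum
        by (intro sum.cong refl) (metis complex_norm_square mult.commute)
      then have "?n\<^sup>2 \<le> C * vnorm B v * ?n"
        using H[rule_format, of "op_app B T v" v] by (simp only: norm_of_real abs_power2)
      then have "?n * ?n \<le> C * vnorm B v * ?n"
        by (simp add: power2_eq_square)
      then show "?n \<le> C * vnorm B v"
        using assms by (cases "?n = 0") (auto simp: less_le)
    qed
  qed
qed

lemma op_bound_nonneg: "op_bound T C \<Longrightarrow> 0 \<le> C"
  by (simp add: op_bound_def)

lemma op_bound_local_bound: "op_bound T C \<Longrightarrow> finite B \<Longrightarrow> local_bound B T C"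
  by (subst local_bound_iff_form) (auto simp: op_bound_def vnorm_def)

lemma op_bound_iff_local_bound:
  "op_bound T C \<longleftrightarrow> 0 \<le> C \<and> (\<forall>F. finite F \<longrightarrow> local_bound F T C)"
  by (auto simp: op_bound_def vnorm_def local_bound_iff_form)

lemma op_bound_mono: "op_bound T C \<Longrightarrow> C \<le> D \<Longrightarrow> op_bound T D"
  unfolding op_bound_iff_local_bound by (auto intro: local_bound_mono)

lemma op_bound_add: "op_bound S C \<Longrightarrow> op_bound T D \<Longrightarrow> op_bound (S \<oplus>\<^sub>o T) (C + D)"
  by (auto simp: op_bound_iff_local_bound intro: local_bound_add)

lemma op_bound_scale: "op_bound T C \<Longrightarrow> op_bound (op_scale c T) (cmod c * C)"
  by (auto simp: op_bound_iff_local_bound intro: local_bound_scale)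

lemma op_diff_eq: "S \<ominus>\<^sub>o T = S \<oplus>\<^sub>o op_scale (-1) T"
  by (simp add: op_diff_def op_add_def op_scale_def)

lemma op_bound_diff: "op_bound S C \<Longrightarrow> op_bound T D \<Longrightarrow> op_bound (S \<ominus>\<^sub>o T) (C + D)"
  using op_bound_add[of S C "op_scale (-1) T" D] op_bound_scale[of T D "-1"]
  by (simp add: op_diff_eq)

lemma op_bound_adj:
  assumes "op_bound T C"
  shows "op_bound (adj T) C"
  unfolding op_bound_def
proof (intro conjI allI impI)
  show "0 \<le> C" using assms by (rule op_bound_nonneg)
  fix F :: "'a set" and v w :: "'a \<Rightarrow> complex" assume F: "finite F"
  have "(\<Sum>i\<in>F. \<Sum>j\<in>F. cnj (w i) * adj T i j * v j)
      = cnj (\<Sum>i\<in>F. \<Sum>j\<in>F. cnj (v j) * T j i * w i)"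
    by (simp add: adj_def mult_ac)
  also have "(\<Sum>i\<in>F. \<Sum>j\<in>F. cnj (v j) * T j i * w i) = (\<Sum>j\<in>F. \<Sum>i\<in>F. cnj (v j) * T j i * w i)"
    by (rule sum.swap)
  finally have "cmod (\<Sum>i\<in>F. \<Sum>j\<in>F. cnj (w i) * adj T i j * v j)
      = cmod (\<Sum>j\<in>F. \<Sum>i\<in>F. cnj (v j) * T j i * w i)"
    by (simp only: complex_mod_cnj)
  also have "\<dots> \<le> C * L2_set (\<lambda>i. cmod (w i)) F * L2_set (\<lambda>i. cmod (v i)) F"
    using assms F by (simp add: op_bound_def)
  finally show "cmod (\<Sum>i\<in>F. \<Sum>j\<in>F. cnj (w i) * adj T i j * v j)
      \<le> C * L2_set (\<lambda>i. cmod (v i)) F * L2_set (\<lambda>i. cmod (w i)) F"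
    by (simp add: mult_ac)
qed

lemma op_bound_entry:
  assumes "op_bound T C"
  shows "cmod (T i j) \<le> C"
proof -
  let ?v = "\<lambda>k. if k = j then 1 else 0 :: complex" and ?w = "\<lambda>k. if k = i then 1 else 0 :: complex"
  have "(\<Sum>a\<in>{i,j}. \<Sum>b\<in>{i,j}. cnj (?w a) * T a b * ?v b) = T i j"
    by (cases "i = j") auto
  moreover have "L2_set (\<lambda>k. cmod (?v k)) {i,j} = 1" "L2_set (\<lambda>k. cmod (?w k)) {i,j} = 1"
    by (cases "i = j"; simp add: L2_set_def)+
  moreover have "cmod (\<Sum>a\<in>{i,j}. \<Sum>b\<in>{i,j}. cnj (?w a) * T a b * ?v b)
      \<le> C * L2_set (\<lambda>k. cmod (?v k)) {i,j} * L2_set (\<lambda>k. cmod (?w k)) {i,j}"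
    using assms[unfolded op_bound_def, THEN conjunct2, rule_format, of "{i,j}" ?w ?v] by simp
  ultimately show ?thesis by simp
qed

lemma opnorm_le: "op_bound T C \<Longrightarrow> opnorm T \<le> C"
  unfolding opnorm_def by (rule cInf_lower) (auto intro!: bdd_belowI[of _ 0] op_bound_nonneg)

text \<open>
  Together with \<open>opnorm_le\<close> this turns every condition on \<open>opnorm\<close> into one on \<open>op_bound\<close>, up to an
  arbitrarily small loss in the constant.
\<close>

lemma opnorm_less:
  assumes "bounded_op T" "opnorm T < e"
  shows "op_bound T e"
proof -
  have "{C. op_bound T C} \<noteq> {}" using assms(1) by (auto simp: bounded_op_def)
  then obtain C where "op_bound T C" "C < e"
    using assms(2) unfolding opnorm_def by (metis cInf_lessD mem_Collect_eq)
  then show ?thesis by (meson less_imp_le op_bound_mono)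
qed

lemma bounded_op_diff: "bounded_op S \<Longrightarrow> bounded_op T \<Longrightarrow> bounded_op (S \<ominus>\<^sub>o T)"
  unfolding bounded_op_def by (meson op_bound_diff)

lemma norm_closureI:
  assumes "bounded_op T" "\<And>e. e > 0 \<Longrightarrow> \<exists>s\<in>S. op_bound (T \<ominus>\<^sub>o s) e"
  shows "T \<in> norm_closure S"
  unfolding norm_closure_def
proof (intro CollectI conjI allI impI assms(1))
  fix e :: real assume "e > 0"
  then obtain s where "s \<in> S" "op_bound (T \<ominus>\<^sub>o s) (e/2)"
    using assms(2)[of "e/2"] by auto
  then show "\<exists>s\<in>S. opnorm (T \<ominus>\<^sub>o s) < e"
    using opnorm_le \<open>e > 0\<close> by (intro bexI[of _ s]) fastforce+
qed

lemma norm_closureD: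
  assumes "T \<in> norm_closure S" "\<And>s. s \<in> S \<Longrightarrow> bounded_op s" "e > 0"
  obtains s where "s \<in> S" "op_bound (T \<ominus>\<^sub>o s) e"
proof -
  obtain s where "s \<in> S" "opnorm (T \<ominus>\<^sub>o s) < e"
    using assms unfolding norm_closure_def by blast
  moreover have "bounded_op (T \<ominus>\<^sub>o s)"
    using assms(1,2) \<open>s \<in> S\<close> by (intro bounded_op_diff) (auto simp: norm_closure_def)
  ultimately show thesis using that opnorm_less by blast
qed

section \<open>Block-diagonal operators\<close>

definition fib :: "('i \<Rightarrow> 'k) \<Rightarrow> 'k \<Rightarrow> 'i set" where
  "fib b k = {i. b i = k}"

definition blkdiag :: "('i \<Rightarrow> 'k) \<Rightarrow> 'i oper \<Rightarrow> bool" where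
  "blkdiag b T \<longleftrightarrow> (\<forall>i j. b i \<noteq> b j \<longrightarrow> T i j = 0)"

definition block_part :: "('i \<Rightarrow> 'k) \<Rightarrow> 'k \<Rightarrow> 'i oper \<Rightarrow> 'i oper" where
  "block_part b k T = (\<lambda>i j. if b i = k \<and> b j = k then T i j else 0)"

text \<open>
  For a map \<open>b\<close> with finite fibres, \<open>BD b\<close> is the product and \<open>C0 b\<close> the C*-direct sum of the full
  matrix algebras on the fibres.
\<close>

definition BD :: "('i \<Rightarrow> 'k) \<Rightarrow> 'i oper set" where
  "BD b = {T. bounded_op T \<and> blkdiag b T}"

definition C0 :: "('i \<Rightarrow> 'k) \<Rightarrow> 'i oper set" where
  "C0 b = {T \<in> BD b. \<forall>e>0. finite {k. \<not> local_bound (fib b k) T e}}"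

definition unit_op :: "'i \<Rightarrow> 'i \<Rightarrow> 'i oper" where
  "unit_op i j = (\<lambda>p q. if p = i \<and> q = j then 1 else 0)"

lemma op_mult_finite:
  assumes "finite F" "\<And>k. k \<notin> F \<Longrightarrow> S i k * T k j = 0"
  shows "(S \<odot>\<^sub>o T) i j = (\<Sum>k\<in>F. S i k * T k j)"
proof -
  have "(S \<odot>\<^sub>o T) i j = (\<Sum>\<^sub>\<infinity>k\<in>F. S i k * T k j)"
    unfolding op_mult_def by (rule infsum_cong_neutral) (auto simp: assms(2))
  then show ?thesis using assms(1) by simp
qed

text \<open>
  The algebraic part of \<open>cstar_algebra\<close>.  It is needed separately because \<open>star_hom\<close> does not require
  its domain to be closed under the operations.
\<close>

definition star_closed :: "'i oper set \<Rightarrow> bool" where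
  "star_closed A \<longleftrightarrow> op_zero \<in> A \<and> (\<forall>a\<in>A. \<forall>b\<in>A. a \<oplus>\<^sub>o b \<in> A) \<and> (\<forall>c. \<forall>a\<in>A. op_scale c a \<in> A) \<and>
    (\<forall>a\<in>A. \<forall>b\<in>A. a \<odot>\<^sub>o b \<in> A) \<and> (\<forall>a\<in>A. adj a \<in> A)"

lemma star_hom_cong:
  assumes "star_hom A B f" "star_closed A" "\<And>a. a \<in> A \<Longrightarrow> g a = f a"
  shows "star_hom A B g"
  using assms unfolding star_hom_def star_closed_def by simp

lemma star_hom_sum:
  assumes "star_hom A B f" "star_closed A" "finite F" "\<And>s. s \<in> F \<Longrightarrow> h s \<in> A"
  shows "(\<lambda>i j. \<Sum>s\<in>F. c s * h s i j) \<in> A \<and>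
    f (\<lambda>i j. \<Sum>s\<in>F. c s * h s i j) = (\<lambda>i j. \<Sum>s\<in>F. c s * f (h s) i j)"
  using assms(3,4)
proof (induction F rule: finite_induct)
  case empty
  have "f (op_scale 0 op_zero) = op_scale 0 (f op_zero)"
    using assms(1,2) unfolding star_hom_def star_closed_def by blast
  then show ?case using assms(2) by (simp add: op_scale_def op_zero_def star_closed_def)
next
  case (insert x F)
  let ?r = "\<lambda>i j. \<Sum>s\<in>F. c s * h s i j"
  have r: "?r \<in> A" "f ?r = (\<lambda>i j. \<Sum>s\<in>F. c s * f (h s) i j)" using insert by auto
  have x: "op_scale (c x) (h x) \<in> A" using insert assms(2) by (auto simp: star_closed_def)
  have eq: "(\<lambda>i j. \<Sum>s\<in>insert x F. c s * h s i j) = op_scale (c x) (h x) \<oplus>\<^sub>o ?r"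
    using insert by (simp add: op_add_def op_scale_def)
  have "f (op_scale (c x) (h x) \<oplus>\<^sub>o ?r) = f (op_scale (c x) (h x)) \<oplus>\<^sub>o f ?r"
    using assms(1) r x by (simp add: star_hom_def)
  moreover have "f (op_scale (c x) (h x)) = op_scale (c x) (f (h x))"
    using assms(1) insert by (simp add: star_hom_def)
  ultimately show ?case unfolding eq using r x assms(2) insert
    by (auto simp: star_closed_def op_add_def op_scale_def)
qed

lemma cspan_base: "s \<in> S \<Longrightarrow> s \<in> cspan S"
  unfolding cspan_def by (rule CollectI, rule exI[of _ "{s}"], rule exI[of _ "\<lambda>_. 1"]) auto

lemma cspan_sum:
  assumes "finite K" "\<And>k. k \<in> K \<Longrightarrow> t k \<in> cspan S"
  shows "(\<lambda>i j. \<Sum>k\<in>K. d k * t k i j) \<in> cspan S"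
proof -
  have "\<forall>k\<in>K. \<exists>F c. finite F \<and> F \<subseteq> S \<and> t k = (\<lambda>i j. \<Sum>s\<in>F. c s * s i j)"
    using assms(2) unfolding cspan_def by blast
  then obtain F c where F: "\<And>k. k \<in> K \<Longrightarrow> finite (F k) \<and> F k \<subseteq> S \<and> t k = (\<lambda>i j. \<Sum>s\<in>F k. c k s * s i j)"
    unfolding bchoice_iff by blast
  define G where "G = (\<Union>k\<in>K. F k)"
  define e where "e s = (\<Sum>k\<in>K. d k * (if s \<in> F k then c k s else 0))" for s
  have G: "finite G" "G \<subseteq> S" using F assms(1) by (auto simp: G_def)
  have "(\<Sum>k\<in>K. d k * t k i j) = (\<Sum>s\<in>G. e s * s i j)" for i j
  proof -
    have "t k i j = (\<Sum>s\<in>G. (if s \<in> F k then c k s else 0) * s i j)" if "k \<in> K" for k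
    proof -
      have "t k i j = (\<Sum>s\<in>F k. c k s * s i j)" using F[OF that] by metis
      also have "\<dots> = (\<Sum>s\<in>G. (if s \<in> F k then c k s else 0) * s i j)"
        using that G by (intro sum.mono_neutral_cong_left) (auto simp: G_def)
      finally show ?thesis .
    qed
    then have "(\<Sum>k\<in>K. d k * t k i j) = (\<Sum>k\<in>K. \<Sum>s\<in>G. d k * (if s \<in> F k then c k s else 0) * s i j)"
      by (simp add: sum_distrib_left mult.assoc)
    also have "\<dots> = (\<Sum>s\<in>G. \<Sum>k\<in>K. d k * (if s \<in> F k then c k s else 0) * s i j)"
      by (rule sum.swap)
    finally show ?thesis by (simp add: e_def sum_distrib_right)
  qed
  with G show ?thesis
    unfolding cspan_def by (intro CollectI exI[of _ G] exI[of _ e]) simp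
qed

lemma cspan_subset:
  assumes "star_closed A" "S \<subseteq> A"
  shows "cspan S \<subseteq> A"
proof
  fix T assume "T \<in> cspan S"
  then obtain F c where T: "finite F" "F \<subseteq> S" "T = (\<lambda>i j. \<Sum>s\<in>F. c s * s i j)"
    unfolding cspan_def by blast
  have "star_hom A A (\<lambda>x. x)" by (simp add: star_hom_def)
  from star_hom_sum[OF this assms(1) T(1), of "\<lambda>s. s" c] T(2,3) assms(2) show "T \<in> A" by blast
qed

locale block_structure =
  fixes b :: "'i \<Rightarrow> 'k"
  assumes finite_fib [simp]: "finite (fib b k)"
begin

text \<open>
  The norm of a block-diagonal operator is the supremum of the norms of its blocks: the form splits
  into a sum over blocks, to which Cauchy-Schwarz is applied a second time, now for the sequences of
  block norms of the two vectors.
\<close>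

lemma op_bound_blkdiag_iff:
  assumes "blkdiag b T"
  shows "op_bound T C \<longleftrightarrow> 0 \<le> C \<and> (\<forall>k. local_bound (fib b k) T C)"
proof safe
  assume "op_bound T C"
  then show "0 \<le> C" "local_bound (fib b k) T C" for k
    by (auto intro: op_bound_nonneg op_bound_local_bound)
next
  assume C: "0 \<le> C" and L: "\<forall>k. local_bound (fib b k) T C"
  show "op_bound T C"
    unfolding op_bound_def
  proof (intro conjI allI impI C)
    fix F :: "'i set" and v w :: "'i \<Rightarrow> complex"
    assume F: "finite F"
    \<comment> \<open>extend by zero so that sums over \<open>F\<close> become sums over whole fibres\<close>
    define v' where "v' i = (if i \<in> F then v i else 0)" for i
    define w' where "w' i = (if i \<in> F then w i else 0)" for i
    have ext: "(\<Sum>i\<in>{i \<in> F. b i = k}. h i) = (\<Sum>i\<in>fib b k. if i \<in> F then h i else 0)"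
      for k and h :: "'i \<Rightarrow> 'c::comm_monoid_add"
      by (intro sum.mono_neutral_cong_left) (auto simp: fib_def[symmetric] F, auto simp: fib_def)
    have restr: "(\<Sum>j\<in>F. cnj (w i) * T i j * v j) = (\<Sum>j\<in>fib b (b i). cnj (w i) * T i j * v' j)" for i
    proof -
      have "(\<Sum>j\<in>F. cnj (w i) * T i j * v j) = (\<Sum>j\<in>{j \<in> F. b j = b i}. cnj (w i) * T i j * v j)"
        using assms F by (intro sum.mono_neutral_right) (auto simp: blkdiag_def, metis)
      then show ?thesis
        by (simp add: ext v'_def cong: if_cong) (auto intro!: sum.cong)
    qed
    have "(\<Sum>i\<in>F. \<Sum>j\<in>F. cnj (w i) * T i j * v j)
        = (\<Sum>i\<in>F. \<Sum>j\<in>fib b (b i). cnj (w i) * T i j * v' j)"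
      by (simp add: restr)
    also have "\<dots> = (\<Sum>k\<in>b ` F. \<Sum>i\<in>{i\<in>F. b i = k}. \<Sum>j\<in>fib b (b i). cnj (w i) * T i j * v' j)"
      by (rule sum.image_gen[OF F])
    also have "\<dots> = (\<Sum>k\<in>b ` F. \<Sum>i\<in>fib b k. \<Sum>j\<in>fib b k. cnj (w' i) * T i j * v' j)"
      by (simp only: ext) (auto intro!: sum.cong simp: w'_def fib_def)
    finally have form: "(\<Sum>i\<in>F. \<Sum>j\<in>F. cnj (w i) * T i j * v j)
        = (\<Sum>k\<in>b ` F. \<Sum>i\<in>fib b k. \<Sum>j\<in>fib b k. cnj (w' i) * T i j * v' j)" .
    have nrm: "L2_set (\<lambda>k. vnorm (fib b k) u') (b ` F) = L2_set (\<lambda>i. cmod (u i)) F"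
      if u': "\<And>i. u' i = (if i \<in> F then u i else 0)" for u u' :: "'i \<Rightarrow> complex"
    proof -
      have "(\<Sum>k\<in>b ` F. (vnorm (fib b k) u')\<^sup>2) = (\<Sum>k\<in>b ` F. \<Sum>i\<in>{i\<in>F. b i = k}. (cmod (u i))\<^sup>2)"
        unfolding vnorm_sq ext by (auto intro!: sum.cong simp: u')
      also have "\<dots> = (\<Sum>i\<in>F. (cmod (u i))\<^sup>2)"
        by (rule sum.image_gen[OF F, symmetric])
      finally show ?thesis by (simp add: L2_set_def)
    qed
    have "cmod (\<Sum>i\<in>F. \<Sum>j\<in>F. cnj (w i) * T i j * v j)
        \<le> (\<Sum>k\<in>b ` F. C * vnorm (fib b k) v' * vnorm (fib b k) w')"
      unfolding form using L local_bound_iff_form[OF C] by (intro sum_norm_le) blast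
    also have "\<dots> = C * (\<Sum>k\<in>b ` F. \<bar>vnorm (fib b k) v'\<bar> * \<bar>vnorm (fib b k) w'\<bar>)"
      by (simp add: sum_distrib_left mult.assoc)
    also have "\<dots> \<le> C * (L2_set (\<lambda>k. vnorm (fib b k) v') (b ` F) * L2_set (\<lambda>k. vnorm (fib b k) w') (b ` F))"
      by (intro mult_left_mono L2_set_mult_ineq C)
    finally show "cmod (\<Sum>i\<in>F. \<Sum>j\<in>F. cnj (w i) * T i j * v j)
        \<le> C * L2_set (\<lambda>i. cmod (v i)) F * L2_set (\<lambda>i. cmod (w i)) F"
      by (simp add: nrm[OF v'_def] nrm[OF w'_def] mult.assoc)
  qed
qed

lemma BD_iff: "T \<in> BD b \<longleftrightarrow> blkdiag b T \<and> (\<exists>C\<ge>0. \<forall>k. local_bound (fib b k) T C)"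
  by (auto simp: BD_def bounded_op_def op_bound_blkdiag_iff)

lemma op_bound_block_part_iff: "op_bound (block_part b k T) C \<longleftrightarrow> 0 \<le> C \<and> local_bound (fib b k) T C"
proof -
  have 1: "local_bound (fib b k) (block_part b k T) C \<longleftrightarrow> local_bound (fib b k) T C"
    by (rule local_bound_cong) (auto simp: block_part_def fib_def)
  have 2: "local_bound (fib b l) (block_part b k T) C \<longleftrightarrow> local_bound (fib b l) op_zero C" if "l \<noteq> k" for l
    by (rule local_bound_cong) (use that in \<open>auto simp: block_part_def fib_def op_zero_def\<close>)
  have bd: "blkdiag b (block_part b k T)" by (auto simp: blkdiag_def block_part_def)
  show ?thesis
    unfolding op_bound_blkdiag_iff[OF bd] using 1 2 local_bound_zero by metis
qed

lemma op_mult_left: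
  assumes "blkdiag b S"
  shows "(S \<odot>\<^sub>o T) i j = (\<Sum>k\<in>fib b (b i). S i k * T k j)"
  by (rule op_mult_finite[OF finite_fib]) (use assms in \<open>auto simp: blkdiag_def fib_def\<close>)

lemma op_mult_right:
  assumes "blkdiag b T"
  shows "(S \<odot>\<^sub>o T) i j = (\<Sum>k\<in>fib b (b j). S i k * T k j)"
  by (rule op_mult_finite[OF finite_fib]) (use assms in \<open>auto simp: blkdiag_def fib_def\<close>)

lemma blkdiag_mult: "blkdiag b S \<Longrightarrow> blkdiag b T \<Longrightarrow> blkdiag b (S \<odot>\<^sub>o T)"
  by (auto simp: blkdiag_def op_mult_left fib_def intro!: sum.neutral)

lemma local_bound_mult:
  assumes "blkdiag b S" "local_bound (fib b k) S C" "local_bound (fib b k) T D" "0 \<le> C"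
  shows "local_bound (fib b k) (S \<odot>\<^sub>o T) (C * D)"
  by (rule local_bound_comp[OF assms(2,3,4)]) (auto simp: op_mult_left[OF assms(1)] fib_def)

text \<open>
  The adjoint bound is symmetric in the form, so pass through \<open>op_bound\<close> of the single block.
\<close>

lemma local_bound_adj:
  assumes "local_bound (fib b k) T C" "0 \<le> C"
  shows "local_bound (fib b k) (adj T) C"
proof -
  have "block_part b k (adj T) = adj (block_part b k T)" by (auto simp: block_part_def adj_def fun_eq_iff)
  then show ?thesis using assms op_bound_adj op_bound_block_part_iff by metis
qed

lemma C0_sub_BD: "C0 b \<subseteq> BD b"
  by (auto simp: C0_def)

lemma star_closed_BD: "star_closed (BD b)"
  unfolding star_closed_def BD_iff
proof (intro conjI ballI allI)
  show "blkdiag b op_zero" by (simp add: blkdiag_def op_zero_def)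
  show "\<exists>C\<ge>0. \<forall>k. local_bound (fib b k) op_zero C" using local_bound_zero by blast
next
  fix S T assume "S \<in> BD b" "T \<in> BD b"
  then obtain C D where S: "blkdiag b S" "0 \<le> C" "\<And>k. local_bound (fib b k) S C"
    and T: "blkdiag b T" "0 \<le> D" "\<And>k. local_bound (fib b k) T D"
    by (auto simp: BD_iff)
  show "blkdiag b (S \<oplus>\<^sub>o T)" using S T by (simp add: blkdiag_def op_add_def)
  show "\<exists>C\<ge>0. \<forall>k. local_bound (fib b k) (S \<oplus>\<^sub>o T) C"
    using S T by (intro exI[of _ "C + D"]) (auto intro: local_bound_add)
  show "blkdiag b (S \<odot>\<^sub>o T)" using S T by (simp add: blkdiag_mult)
  show "\<exists>C\<ge>0. \<forall>k. local_bound (fib b k) (S \<odot>\<^sub>o T) C"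
    using S T by (intro exI[of _ "C * D"]) (auto intro: local_bound_mult)
  show "blkdiag b (adj S)" using S by (auto simp: blkdiag_def adj_def)
  show "\<exists>C\<ge>0. \<forall>k. local_bound (fib b k) (adj S) C"
    using S by (intro exI[of _ C]) (auto intro: local_bound_adj)
  fix c
  show "blkdiag b (op_scale c S)" using S by (simp add: blkdiag_def op_scale_def)
  show "\<exists>C\<ge>0. \<forall>k. local_bound (fib b k) (op_scale c S) C"
    using S by (intro exI[of _ "cmod c * C"]) (auto intro: local_bound_scale)
qed

lemma C0I:
  assumes "T \<in> BD b" "\<And>e. e > 0 \<Longrightarrow> finite {k. \<not> local_bound (fib b k) T e}"
  shows "T \<in> C0 b"
  using assms by (simp add: C0_def)

lemma C0_mult:
  assumes "S \<in> BD b" "T \<in> C0 b"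
  shows "S \<odot>\<^sub>o T \<in> C0 b" "T \<odot>\<^sub>o S \<in> C0 b"
proof -
  obtain C where S: "blkdiag b S" "0 \<le> C" "\<And>k. local_bound (fib b k) S C"
    using assms by (auto simp: BD_iff)
  have T: "T \<in> BD b" "blkdiag b T" using assms(2) by (auto simp: C0_def BD_def)
  have pos: "0 < C + 1" using S by simp
  have S': "local_bound (fib b k) S (C + 1)" for k
    using S(3) by (rule local_bound_mono) simp
  show "S \<odot>\<^sub>o T \<in> C0 b"
  proof (rule C0I)
    show "S \<odot>\<^sub>o T \<in> BD b" using star_closed_BD assms T by (simp add: star_closed_def)
    fix e :: real assume "e > 0"
    then have fin: "finite {k. \<not> local_bound (fib b k) T (e / (C + 1))}"
      using assms(2) pos by (simp add: C0_def)
    have "local_bound (fib b k) (S \<odot>\<^sub>o T) e" if "local_bound (fib b k) T (e / (C + 1))" for k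
      using local_bound_mult[OF S(1) S' that] pos by simp
    then show "finite {k. \<not> local_bound (fib b k) (S \<odot>\<^sub>o T) e}"
      by (intro finite_subset[OF _ fin]) auto
  qed
  show "T \<odot>\<^sub>o S \<in> C0 b"
  proof (rule C0I)
    show "T \<odot>\<^sub>o S \<in> BD b" using star_closed_BD assms T by (simp add: star_closed_def)
    fix e :: real assume "e > 0"
    then have fin: "finite {k. \<not> local_bound (fib b k) T (e / (C + 1))}"
      using assms(2) pos by (simp add: C0_def)
    have "local_bound (fib b k) (T \<odot>\<^sub>o S) e" if "local_bound (fib b k) T (e / (C + 1))" for k
      using local_bound_mult[OF T(2) that S'] pos \<open>e > 0\<close> by simp
    then show "finite {k. \<not> local_bound (fib b k) (T \<odot>\<^sub>o S) e}"
      by (intro finite_subset[OF _ fin]) auto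
  qed
qed

lemma star_closed_C0: "star_closed (C0 b)"
  unfolding star_closed_def
proof (intro conjI ballI allI)
  show "op_zero \<in> C0 b"
    using star_closed_BD by (simp add: C0_def star_closed_def local_bound_zero)
next
  fix S T assume S: "S \<in> C0 b" and T: "T \<in> C0 b"
  have ST: "S \<in> BD b" "T \<in> BD b" using S T by (auto simp: C0_def)
  show "S \<odot>\<^sub>o T \<in> C0 b" using C0_mult ST T by blast
  show "S \<oplus>\<^sub>o T \<in> C0 b"
  proof (rule C0I)
    show "S \<oplus>\<^sub>o T \<in> BD b" using star_closed_BD ST by (simp add: star_closed_def)
    fix e :: real assume "e > 0"
    then have fin: "finite ({k. \<not> local_bound (fib b k) S (e / 2)} \<union> {k. \<not> local_bound (fib b k) T (e / 2)})"
      using S T by (simp add: C0_def)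
    have "local_bound (fib b k) (S \<oplus>\<^sub>o T) e"
      if "local_bound (fib b k) S (e / 2)" "local_bound (fib b k) T (e / 2)" for k
      using local_bound_add[OF that] by simp
    then show "finite {k. \<not> local_bound (fib b k) (S \<oplus>\<^sub>o T) e}"
      by (intro finite_subset[OF _ fin]) auto
  qed
  show "adj S \<in> C0 b"
  proof (rule C0I)
    show "adj S \<in> BD b" using star_closed_BD ST by (simp add: star_closed_def)
    fix e :: real assume e: "e > 0"
    then have fin: "finite {k. \<not> local_bound (fib b k) S e}" using S by (simp add: C0_def)
    show "finite {k. \<not> local_bound (fib b k) (adj S) e}"
      by (intro finite_subset[OF _ fin]) (use e in \<open>auto intro: local_bound_adj\<close>)
  qed
  fix c
  show "op_scale c S \<in> C0 b"
  proof (rule C0I)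
    show "op_scale c S \<in> BD b" using star_closed_BD ST by (simp add: star_closed_def)
    fix e :: real assume e: "e > 0"
    have pos: "0 < cmod c + 1" by (simp add: add_nonneg_pos)
    then have fin: "finite {k. \<not> local_bound (fib b k) S (e / (cmod c + 1))}"
      using S e by (simp add: C0_def)
    have "local_bound (fib b k) (op_scale c S) e" if "local_bound (fib b k) S (e / (cmod c + 1))" for k
    proof (rule local_bound_mono[OF local_bound_scale[OF that]])
      show "cmod c * (e / (cmod c + 1)) \<le> e"
        using pos e by (simp add: field_simps)
    qed
    then show "finite {k. \<not> local_bound (fib b k) (op_scale c S) e}"
      by (intro finite_subset[OF _ fin]) auto
  qed
qed

lemma finite_blocks_C0:
  assumes "T \<in> BD b" "finite K" "\<And>i j. b i \<notin> K \<Longrightarrow> T i j = 0"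
  shows "T \<in> C0 b"
proof (rule C0I[OF assms(1)])
  fix e :: real assume e: "e > 0"
  have "local_bound (fib b k) T e" if "k \<notin> K" for k
  proof -
    have "local_bound (fib b k) T e \<longleftrightarrow> local_bound (fib b k) op_zero e"
      by (rule local_bound_cong) (use that assms(3) in \<open>auto simp: fib_def op_zero_def\<close>)
    then show ?thesis using e by (simp add: local_bound_zero)
  qed
  then show "finite {k. \<not> local_bound (fib b k) T e}"
    by (intro finite_subset[OF _ assms(2)]) auto
qed

lemma block_part_C0:
  assumes "T \<in> BD b"
  shows "block_part b k T \<in> C0 b"
proof (rule finite_blocks_C0)
  obtain C where "0 \<le> C" "local_bound (fib b k) T C"
    using assms by (auto simp: BD_iff)
  then have "bounded_op (block_part b k T)" using op_bound_block_part_iff by (auto simp: bounded_op_def)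
  then show "block_part b k T \<in> BD b" by (auto simp: BD_def blkdiag_def block_part_def)
  show "finite {k}" by simp
qed (auto simp: block_part_def)

lemma op_one_BD: "op_one \<in> BD b"
proof -
  have "local_bound (fib b k) op_one 1" for k
  proof -
    have "op_app (fib b k) op_one v i = v i" if "i \<in> fib b k" for v i
      using that by (simp add: op_app_def op_one_def if_distrib[where f="\<lambda>x. x * _"] cong: if_cong)
    then have "vnorm (fib b k) (op_app (fib b k) op_one v) = vnorm (fib b k) v" for v
      by (intro vnorm_cong) simp
    then show ?thesis by (simp add: local_bound_def)
  qed
  then show ?thesis unfolding BD_iff
    by (auto simp: blkdiag_def op_one_def intro!: exI[of _ 1])
qed

lemma unit_op_C0:
  assumes "b i = b j"
  shows "unit_op i j \<in> C0 b"
proof (rule finite_blocks_C0)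
  have "op_bound (unit_op i j) 1"
    unfolding op_bound_iff_local_bound
  proof (intro conjI allI impI)
    fix F :: "'i set" assume F: "finite F"
    show "local_bound F (unit_op i j) 1"
    proof (subst local_bound_iff_form, simp, intro allI)
      fix v w :: "'i \<Rightarrow> complex"
      have le: "cmod (u k) \<le> vnorm F u" if "k \<in> F" for u k
        using member_le_L2_set[OF F that] by (simp add: vnorm_def)
      have "(\<Sum>a\<in>F. \<Sum>c\<in>F. cnj (w a) * unit_op i j a c * v c)
          = (\<Sum>a\<in>F. if a = i then (\<Sum>c\<in>F. if c = j then cnj (w a) * v c else 0) else 0)"
        by (intro sum.cong refl) (auto simp: unit_op_def intro!: sum.cong sum.neutral)
      also have "\<dots> = (if i \<in> F \<and> j \<in> F then cnj (w i) * v j else 0)"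
        using F by simp
      finally show "cmod (\<Sum>a\<in>F. \<Sum>c\<in>F. cnj (w a) * unit_op i j a c * v c) \<le> 1 * vnorm F v * vnorm F w"
        by (auto simp: norm_mult mult.commute[of "vnorm F v"] intro!: mult_mono le)
    qed
  qed simp
  then show "unit_op i j \<in> BD b"
    using assms by (auto simp: BD_def bounded_op_def blkdiag_def unit_op_def)
  show "finite {b i}" by simp
qed (auto simp: unit_op_def)

text \<open>
  Entries are continuous in the norm, so limits stay block-diagonal; a bound on \<open>T - s\<close> bounds every
  block of it at once, so all but finitely many blocks of \<open>T\<close> are small when those of \<open>s\<close> are.
\<close>

lemma C0_norm_closed: "norm_closure (C0 b) \<subseteq> C0 b"
proof
  fix T assume T: "T \<in> norm_closure (C0 b)"
  have app: "\<exists>s\<in>C0 b. op_bound (T \<ominus>\<^sub>o s) e" if "e > 0" for e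
    using norm_closureD[OF T _ that] by (auto simp: C0_def BD_def)
  have bd: "blkdiag b T"
    unfolding blkdiag_def
  proof (intro allI impI)
    fix i j assume ij: "b i \<noteq> b j"
    have "cmod (T i j) \<le> e" if e: "e > 0" for e
    proof -
      obtain s where s: "s \<in> C0 b" "op_bound (T \<ominus>\<^sub>o s) e" using app e by blast
      then have "s i j = 0" using ij by (auto simp: C0_def BD_def blkdiag_def)
      then show ?thesis using op_bound_entry[OF s(2), of i j] by (simp add: op_diff_def)
    qed
    then have "cmod (T i j) \<le> 0" by (rule field_le_epsilon) simp
    then show "T i j = 0" by simp
  qed
  show "T \<in> C0 b"
  proof (rule C0I)
    show "T \<in> BD b" using T bd by (simp add: BD_def norm_closure_def)
    fix e :: real assume e: "e > 0"
    then obtain s where s: "s \<in> C0 b" "op_bound (T \<ominus>\<^sub>o s) (e/2)" using app[of "e/2"] by auto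
    have fin: "finite {k. \<not> local_bound (fib b k) s (e/2)}" using s e by (simp add: C0_def)
    have "T = (T \<ominus>\<^sub>o s) \<oplus>\<^sub>o s" by (simp add: op_diff_def op_add_def)
    then have "local_bound (fib b k) T e" if "local_bound (fib b k) s (e/2)" for k
      using local_bound_add[OF op_bound_local_bound[OF s(2)] that] by simp
    then show "finite {k. \<not> local_bound (fib b k) T e}"
      by (intro finite_subset[OF _ fin]) auto
  qed
qed

text \<open>
  A vector annihilated by the algebra is annihilated by the diagonal matrix units, which read off its
  coordinates.
\<close>

lemma cstar_algebra_C0: "cstar_algebra (C0 b)"
proof -
  have "v = (\<lambda>j. 0)" if v: "\<forall>a\<in>C0 b. \<forall>i. (\<Sum>\<^sub>\<infinity>j. a i j * v j) = 0" for v
  proof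
    fix i
    have "(\<Sum>\<^sub>\<infinity>j. unit_op i i i j * v j) = (\<Sum>\<^sub>\<infinity>j\<in>{i}. unit_op i i i j * v j)"
      by (rule infsum_cong_neutral) (auto simp: unit_op_def)
    then have "(\<Sum>\<^sub>\<infinity>j. unit_op i i i j * v j) = v i" by (simp add: unit_op_def)
    then show "v i = 0" using v unit_op_C0[of i i] by auto
  qed
  then show ?thesis
    using star_closed_C0 C0_norm_closed
    unfolding cstar_algebra_def star_closed_def by (auto simp: C0_def BD_def)
qed

text \<open>
  The density principle for all closures below: the finitely many blocks of norm above \<open>e\<close> already
  approximate \<open>x\<close> up to \<open>e\<close>, so it suffices to reach single blocks.
\<close>

lemma C0_approx:
  assumes x: "x \<in> C0 b" and cuts: "\<And>k. block_part b k x \<in> cspan S"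
  shows "x \<in> norm_closure (cspan S)"
proof (rule norm_closureI)
  show "bounded_op x" using x by (simp add: C0_def BD_def)
  fix e :: real assume e: "e > 0"
  define K where "K = {k. \<not> local_bound (fib b k) x e}"
  have K: "finite K" using x e by (simp add: K_def C0_def)
  define s where "s = (\<lambda>i j. \<Sum>k\<in>K. 1 * block_part b k x i j)"
  have "s \<in> cspan S" unfolding s_def by (rule cspan_sum[OF K cuts])
  moreover have "op_bound (x \<ominus>\<^sub>o s) e"
  proof -
    have bx: "blkdiag b x" using x by (simp add: C0_def BD_def)
    have s: "s i j = (if b i \<in> K then x i j else 0)" for i j
    proof -
      have "s i j = (\<Sum>k\<in>K. if k = b i then x i j else 0)"
        using bx by (auto simp: s_def block_part_def blkdiag_def intro!: sum.cong)
      then show ?thesis using K by simp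
    qed
    have "local_bound (fib b k) (x \<ominus>\<^sub>o s) e" for k
    proof (cases "k \<in> K")
      case True
      then have "local_bound (fib b k) (x \<ominus>\<^sub>o s) e \<longleftrightarrow> local_bound (fib b k) op_zero e"
        by (intro local_bound_cong) (auto simp: op_diff_def s op_zero_def fib_def)
      then show ?thesis using e by (simp add: local_bound_zero)
    next
      case False
      then have "local_bound (fib b k) (x \<ominus>\<^sub>o s) e \<longleftrightarrow> local_bound (fib b k) x e"
        by (intro local_bound_cong) (auto simp: op_diff_def s fib_def)
      then show ?thesis using False by (simp add: K_def)
    qed
    moreover have "blkdiag b (x \<ominus>\<^sub>o s)" using bx by (simp add: blkdiag_def op_diff_def s)
    ultimately show ?thesis using e by (simp add: op_bound_blkdiag_iff)
  qed
  ultimately show "\<exists>s\<in>cspan S. op_bound (x \<ominus>\<^sub>o s) e" by blast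
qed

lemma block_part_as_units:
  "block_part b k T = (\<lambda>p q. \<Sum>(i, j)\<in>fib b k \<times> fib b k. T i j * unit_op i j p q)"
proof (intro ext)
  fix p q
  have "(\<Sum>(i, j)\<in>fib b k \<times> fib b k. T i j * unit_op i j p q)
      = (\<Sum>z\<in>fib b k \<times> fib b k. if z = (p, q) then T p q else 0)"
    by (intro sum.cong refl) (auto simp: unit_op_def split: if_splits)
  also have "\<dots> = block_part b k T p q" by (simp add: block_part_def) (auto simp: fib_def)
  finally show "block_part b k T p q = (\<Sum>(i, j)\<in>fib b k \<times> fib b k. T i j * unit_op i j p q)" by simp
qed

lemma op_mult_block_part_one:
  assumes "blkdiag b T"
  shows "T \<odot>\<^sub>o block_part b k op_one = block_part b k T"
proof (intro ext)
  fix i j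
  have "(T \<odot>\<^sub>o block_part b k op_one) i j = (\<Sum>l\<in>{j}. T i l * block_part b k op_one l j)"
    by (rule op_mult_finite) (auto simp: block_part_def op_one_def)
  then show "(T \<odot>\<^sub>o block_part b k op_one) i j = block_part b k T i j"
    using assms by (auto simp: block_part_def op_one_def blkdiag_def)
qed

text \<open>
  Operators commuting with all matrix units inside the blocks are scalar on each block, so the
  commutant of \<open>C0 b\<close> consists of such operators and contains the block projections.  Commuting with
  the block projections forces an operator to be block-diagonal, and a block-diagonal operator
  commutes with every operator that is scalar on blocks.
\<close>

lemma multipliers_C0: "multipliers (C0 b) = BD b"
proof
  show "multipliers (C0 b) \<subseteq> BD b"
  proof
    fix x assume x: "x \<in> multipliers (C0 b)"
    then have xc: "x \<in> commutant (commutant (C0 b))" by (simp add: multipliers_def)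
    have "x i j = 0" if ij: "b i \<noteq> b j" for i j
    proof -
      let ?P = "block_part b (b j) op_one"
      have P: "bounded_op ?P" "blkdiag b ?P"
        using block_part_C0[OF op_one_BD] by (auto simp: C0_def BD_def)
      have PR: "(T \<odot>\<^sub>o ?P) i' j' = (if b j' = b j then T i' j' else 0)" for T i' j'
      proof -
        have "(T \<odot>\<^sub>o ?P) i' j' = (\<Sum>l\<in>{j'}. T i' l * ?P l j')"
          by (rule op_mult_finite) (auto simp: block_part_def op_one_def)
        then show ?thesis by (simp add: block_part_def op_one_def)
      qed
      have PL: "(?P \<odot>\<^sub>o T) i' j' = (if b i' = b j then T i' j' else 0)" for T i' j'
      proof -
        have "(?P \<odot>\<^sub>o T) i' j' = (\<Sum>l\<in>{i'}. ?P i' l * T l j')"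
          by (rule op_mult_finite) (auto simp: block_part_def op_one_def)
        then show ?thesis by (simp add: block_part_def op_one_def)
      qed
      have "?P \<in> commutant (C0 b)"
        unfolding commutant_def
      proof (intro CollectI conjI ballI P(1) ext)
        fix s i' j' assume "s \<in> C0 b"
        then have "blkdiag b s" by (simp add: C0_def BD_def)
        then show "(?P \<odot>\<^sub>o s) i' j' = (s \<odot>\<^sub>o ?P) i' j'"
          unfolding PR PL blkdiag_def by metis
      qed
      then have "x \<odot>\<^sub>o ?P = ?P \<odot>\<^sub>o x" using xc by (simp add: commutant_def)
      then have "(x \<odot>\<^sub>o ?P) i j = (?P \<odot>\<^sub>o x) i j" by simp
      then show ?thesis using ij unfolding PR PL by simp
    qed
    then show "x \<in> BD b" using xc by (auto simp: BD_def blkdiag_def commutant_def)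
  qed
  show "BD b \<subseteq> multipliers (C0 b)"
  proof
    fix x assume x: "x \<in> BD b"
    have "x \<odot>\<^sub>o s = s \<odot>\<^sub>o x" if s: "s \<in> commutant (C0 b)" for s
    proof -
      have key: "s p i * (if q = j then 1 else 0) = (if p = i then 1 else 0) * s j q"
        if "b i = b j" for p q i j
      proof -
        have "(s \<odot>\<^sub>o unit_op i j) p q = (\<Sum>l\<in>{i}. s p l * unit_op i j l q)"
          by (rule op_mult_finite) (auto simp: unit_op_def)
        moreover have "(unit_op i j \<odot>\<^sub>o s) p q = (\<Sum>l\<in>{j}. unit_op i j p l * s l q)"
          by (rule op_mult_finite) (auto simp: unit_op_def)
        moreover have "s \<odot>\<^sub>o unit_op i j = unit_op i j \<odot>\<^sub>o s"
          using s unit_op_C0[OF that] by (simp add: commutant_def)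
        ultimately show ?thesis by (simp add: unit_op_def split: if_splits)
      qed
      have off: "s p i = 0" if "p \<noteq> i" for p i
        using key[of i i p i] that by simp
      have diag: "s i i = s j j" if "b i = b j" for i j
        using key[OF that, of i j] by simp
      show ?thesis
      proof (intro ext)
        fix p q
        have "(x \<odot>\<^sub>o s) p q = (\<Sum>l\<in>{q}. x p l * s l q)"
          by (rule op_mult_finite) (auto simp: off)
        moreover have "(s \<odot>\<^sub>o x) p q = (\<Sum>l\<in>{p}. s p l * x l q)"
          by (rule op_mult_finite) (auto simp: off)
        moreover have "x p q = 0" if "b p \<noteq> b q"
          using x that by (simp add: BD_def blkdiag_def)
        ultimately show "(x \<odot>\<^sub>o s) p q = (s \<odot>\<^sub>o x) p q"
          using diag[of p q] by (cases "b p = b q") auto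
      qed
    qed
    then have "x \<in> commutant (commutant (C0 b))"
      using x by (auto simp: commutant_def BD_def)
    then show "x \<in> multipliers (C0 b)"
      using C0_mult[OF x] by (simp add: multipliers_def)
  qed
qed

end

section \<open>Tensor products of block algebras\<close>

lemma unit_op_tensor: "unit_op i j \<otimes>\<^sub>o unit_op k l = unit_op (i, k) (j, l)"
  by (auto simp: op_tensor_def unit_op_def fun_eq_iff)

locale two_block_structures = B: block_structure b + C: block_structure c
  for b :: "'i \<Rightarrow> 'k" and c :: "'j \<Rightarrow> 'l"
begin

lemma fib_prod: "fib (map_prod b c) (k, l) = fib b k \<times> fib c l"
  by (auto simp: fib_def)

sublocale P: block_structure "map_prod b c"
proof
  show "finite (fib (map_prod b c) z)" for z
    by (cases z) (simp add: fib_prod)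
qed

text \<open>
  A block of \<open>S \<otimes> T\<close> can only be large if the corresponding blocks of both factors are not small,
  because the other factor is bounded uniformly.
\<close>

lemma tensor_C0:
  assumes S: "S \<in> C0 b" and T: "T \<in> C0 c"
  shows "S \<otimes>\<^sub>o T \<in> C0 (map_prod b c)"
proof (rule P.C0I)
  obtain C D where SC: "blkdiag b S" "0 \<le> C" "\<And>k. local_bound (fib b k) S C"
    and TD: "blkdiag c T" "0 \<le> D" "\<And>k. local_bound (fib c k) T D"
    using assms by (auto simp: B.BD_iff C.BD_iff C0_def)
  have "blkdiag (map_prod b c) (S \<otimes>\<^sub>o T)"
    using SC TD by (auto simp: blkdiag_def op_tensor_def)
  moreover have "local_bound (fib (map_prod b c) z) (S \<otimes>\<^sub>o T) (C * D)" for z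
    by (cases z) (auto simp: fib_prod intro!: local_bound_tensor SC TD)
  ultimately show "S \<otimes>\<^sub>o T \<in> BD (map_prod b c)"
    using SC TD by (auto simp: P.BD_iff intro!: exI[of _ "C * D"])
  fix e :: real assume e: "e > 0"
  \<comment> \<open>\<open>D + 1\<close> and \<open>C + 1\<close> avoid division by zero when a bound vanishes\<close>
  define e1 where "e1 = e / (D + 1)"
  define e2 where "e2 = e / (C + 1)"
  have pos: "e1 > 0" "e2 > 0" using e SC TD by (auto simp: e1_def e2_def)
  have bnd: "e1 * D \<le> e" "C * e2 \<le> e" using e SC(2) TD(2) by (auto simp: e1_def e2_def field_simps)
  have fin: "finite ({k. \<not> local_bound (fib b k) S e1} \<times> {l. \<not> local_bound (fib c l) T e2})"
    using S T pos by (simp add: C0_def)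
  have "local_bound (fib (map_prod b c) (k, l)) (S \<otimes>\<^sub>o T) e"
    if "local_bound (fib b k) S e1 \<or> local_bound (fib c l) T e2" for k l
    using that
  proof
    assume "local_bound (fib b k) S e1"
    then show ?thesis unfolding fib_prod using pos bnd TD
      by (intro local_bound_mono[OF local_bound_tensor bnd(1)]) auto
  next
    assume "local_bound (fib c l) T e2"
    then show ?thesis unfolding fib_prod using pos bnd SC
      by (intro local_bound_mono[OF local_bound_tensor bnd(2)]) auto
  qed
  then show "finite {z. \<not> local_bound (fib (map_prod b c) z) (S \<otimes>\<^sub>o T) e}"
    by (intro finite_subset[OF _ fin]) auto
qed

text \<open>
  One inclusion holds because \<open>C0\<close> of the product structure is a norm-closed algebra; for the other,
  a single block is a finite combination of tensor products of matrix units.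
\<close>

lemma alg_tensor_C0: "C0 b \<otimes>\<^sub>m C0 c = C0 (map_prod b c)"
proof
  let ?S = "{s \<otimes>\<^sub>o t |s t. s \<in> C0 b \<and> t \<in> C0 c}"
  have sub: "cspan ?S \<subseteq> C0 (map_prod b c)"
    by (rule cspan_subset[OF P.star_closed_C0]) (auto intro: tensor_C0)
  have "norm_closure (cspan ?S) \<subseteq> norm_closure (C0 (map_prod b c))"
    using sub unfolding norm_closure_def by blast
  then show "C0 b \<otimes>\<^sub>m C0 c \<subseteq> C0 (map_prod b c)"
    using P.C0_norm_closed unfolding alg_tensor_def by blast
  show "C0 (map_prod b c) \<subseteq> C0 b \<otimes>\<^sub>m C0 c"
  proof
    fix x assume x: "x \<in> C0 (map_prod b c)"
    have "block_part (map_prod b c) z x \<in> cspan ?S" for z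
    proof -
      let ?F = "fib (map_prod b c) z \<times> fib (map_prod b c) z"
      have "(\<lambda>p q. \<Sum>w\<in>?F. x (fst w) (snd w) * unit_op (fst w) (snd w) p q) \<in> cspan ?S"
      proof (rule cspan_sum)
        fix w assume w: "w \<in> ?F"
        obtain i k j l where w': "w = ((i, k), (j, l))" by (metis prod.exhaust)
        have "unit_op (fst w) (snd w) = unit_op i j \<otimes>\<^sub>o unit_op k l"
          by (simp add: w' unit_op_tensor)
        moreover have "b i = b j" "c k = c l" using w by (auto simp: w' fib_def)
        ultimately show "unit_op (fst w) (snd w) \<in> cspan ?S"
          using B.unit_op_C0 C.unit_op_C0 by (intro cspan_base) blast
      qed simp
      then show ?thesis unfolding P.block_part_as_units by (simp add: case_prod_unfold)
    qed
    then show "x \<in> C0 b \<otimes>\<^sub>m C0 c"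
      unfolding alg_tensor_def by (rule P.C0_approx[OF x])
  qed
qed

end

section \<open>Homomorphisms induced by maps of basis indices\<close>

text \<open>
  If \<open>\<mu>\<close> maps a block of \<open>c\<close> bijectively to a block of \<open>b\<close>, then on that block this is the isomorphism of
  matrix algebras given by identifying the two bases.
\<close>

definition pull :: "('j \<Rightarrow> 'l) \<Rightarrow> ('j \<Rightarrow> 'i) \<Rightarrow> 'i oper \<Rightarrow> 'j oper" where
  "pull c \<mu> T = (\<lambda>r s. if c r = c s then T (\<mu> r) (\<mu> s) else 0)"

lemma pull_tensor:
  "pull (map_prod c c') (map_prod \<mu> \<nu>) (S \<otimes>\<^sub>o T) = pull c \<mu> S \<otimes>\<^sub>o pull c' \<nu> T"
  by (auto simp: pull_def op_tensor_def fun_eq_iff)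

text \<open>
  The bijection is required only between the block of \<open>r\<close> and the block of \<open>\<mu> r\<close>: many blocks of \<open>c\<close> may
  lie over the same block of \<open>b\<close>, as the blocks \<open>(n, m)\<close> with fixed \<open>n m\<close> do for the
  comultiplication.
\<close>

locale block_map = B: block_structure b + C: block_structure c
  for b :: "'i \<Rightarrow> 'k" and c :: "'j \<Rightarrow> 'l" +
  fixes \<mu> :: "'j \<Rightarrow> 'i"
  assumes bij_fib: "bij_betw \<mu> (fib c (c r)) (fib b (b (\<mu> r)))"
begin

lemma same_block: "c r = c s \<Longrightarrow> b (\<mu> r) = b (\<mu> s)"
  using bij_betw_apply[OF bij_fib[of r], of s] by (simp add: fib_def)

lemma inj_block: "c r = c s \<Longrightarrow> \<mu> r = \<mu> s \<Longrightarrow> r = s"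
  using inj_onD[OF bij_betw_imp_inj_on[OF bij_fib[of s]], of r s] by (simp add: fib_def)

lemma blkdiag_pull: "blkdiag c (pull c \<mu> T)"
  by (simp add: blkdiag_def pull_def)

lemma pull_BD:
  assumes "T \<in> BD b"
  shows "pull c \<mu> T \<in> BD c"
proof -
  obtain C where C: "0 \<le> C" "\<And>k. local_bound (fib b k) T C"
    using assms by (auto simp: B.BD_iff)
  have "local_bound (fib c l) (pull c \<mu> T) C" for l
  proof (cases "fib c l = {}")
    case True
    then show ?thesis using C by (simp add: local_bound_def vnorm_def)
  next
    case False
    then obtain r where r: "c r = l" by (auto simp: fib_def)
    show ?thesis
      by (rule local_bound_reindex[OF bij_fib[of r, unfolded r] C(2)])
        (simp add: pull_def fib_def)
  qed
  then show ?thesis using C blkdiag_pull by (auto simp: C.BD_iff)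
qed

lemma pull_mult:
  assumes "blkdiag b T"
  shows "pull c \<mu> (S \<odot>\<^sub>o T) = pull c \<mu> S \<odot>\<^sub>o pull c \<mu> T"
proof (intro ext)
  fix r s
  have "(pull c \<mu> S \<odot>\<^sub>o pull c \<mu> T) r s = (\<Sum>t\<in>fib c (c s). pull c \<mu> S r t * pull c \<mu> T t s)"
    by (rule C.op_mult_right[OF blkdiag_pull])
  also have "\<dots> = (\<Sum>t\<in>fib c (c s). if c r = c s then S (\<mu> r) (\<mu> t) * T (\<mu> t) (\<mu> s) else 0)"
    by (intro sum.cong) (auto simp: pull_def fib_def)
  also have "\<dots> = (if c r = c s then (\<Sum>k\<in>fib b (b (\<mu> s)). S (\<mu> r) k * T k (\<mu> s)) else 0)"
    using sum.reindex_bij_betw[OF bij_fib[of s], of "\<lambda>k. S (\<mu> r) k * T k (\<mu> s)"] by simp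
  also have "\<dots> = pull c \<mu> (S \<odot>\<^sub>o T) r s"
    by (simp add: pull_def B.op_mult_right[OF assms])
  finally show "pull c \<mu> (S \<odot>\<^sub>o T) r s = (pull c \<mu> S \<odot>\<^sub>o pull c \<mu> T) r s" by simp
qed

lemma star_hom_pull: "star_hom (BD b) (BD c) (pull c \<mu>)"
  unfolding star_hom_def
proof (intro conjI ballI allI)
  fix S T assume ST: "S \<in> BD b" "T \<in> BD b"
  show "pull c \<mu> S \<in> BD c" using ST(1) by (rule pull_BD)
  show "pull c \<mu> (S \<odot>\<^sub>o T) = pull c \<mu> S \<odot>\<^sub>o pull c \<mu> T"
    using ST(2) by (intro pull_mult) (simp add: BD_def)
qed (auto simp: pull_def op_add_def op_scale_def adj_def fun_eq_iff)

lemma star_hom_pull_on: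
  assumes "star_closed A" "A \<subseteq> BD b" "\<And>a. a \<in> A \<Longrightarrow> f a = pull c \<mu> a"
  shows "star_hom A (BD c) f"
proof (rule star_hom_cong[OF _ assms(1,3)])
  show "star_hom A (BD c) (pull c \<mu>)"
    using star_hom_pull assms(2) unfolding star_hom_def by blast
qed

text \<open>
  Uniqueness, for homomorphisms defined on \<open>C0 b\<close> as well as on \<open>BD b\<close>.  By linearity \<open>g\<close> and \<open>pull\<close>
  agree on operators supported on one block, in particular on block projections \<open>P\<close>.  The entry of
  \<open>g x\<close> at \<open>(r, s)\<close> is that of \<open>g x (pull P) = g (x P)\<close> for the block projection \<open>P\<close> at \<open>\<mu> s\<close>, and \<open>x P\<close>
  is supported on one block.
\<close>

lemma star_hom_determined:
  assumes A: "C0 b \<subseteq> A" "A \<subseteq> BD b" "star_closed A" and g: "star_hom A (BD c) g"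
    and units: "\<And>i j. b i = b j \<Longrightarrow> g (unit_op i j) = pull c \<mu> (unit_op i j)"
    and x: "x \<in> A"
  shows "g x = pull c \<mu> x"
proof -
  have part: "g (block_part b k y) = pull c \<mu> (block_part b k y)" for k y
  proof -
    let ?F = "fib b k \<times> fib b k" and ?h = "\<lambda>z. unit_op (fst z) (snd z)"
    let ?c = "\<lambda>z. y (fst z) (snd z)"
    have mem: "?h z \<in> C0 b" if "z \<in> ?F" for z
      using that by (intro B.unit_op_C0) (auto simp: fib_def)
    have eq: "block_part b k y = (\<lambda>p q. \<Sum>z\<in>?F. ?c z * ?h z p q)"
      unfolding B.block_part_as_units by (simp add: case_prod_unfold)
    have fin: "finite ?F" by simp
    have "g (block_part b k y) = (\<lambda>p q. \<Sum>z\<in>?F. ?c z * g (?h z) p q)"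
      unfolding eq using mem A(1) by (intro star_hom_sum[OF g A(3) fin, THEN conjunct2]) auto
    moreover have "pull c \<mu> (block_part b k y) = (\<lambda>p q. \<Sum>z\<in>?F. ?c z * pull c \<mu> (?h z) p q)"
      unfolding eq using mem B.C0_sub_BD
      by (intro star_hom_sum[OF star_hom_pull B.star_closed_BD fin, THEN conjunct2]) auto
    moreover have "g (?h z) = pull c \<mu> (?h z)" if "z \<in> ?F" for z
      using that by (intro units) (auto simp: fib_def)
    ultimately show ?thesis by simp
  qed
  have gx: "g x \<in> BD c" using g x by (simp add: star_hom_def)
  have bx: "blkdiag b x" using x A by (auto simp: BD_def)
  show ?thesis
  proof (intro ext)
    fix r s
    show "g x r s = pull c \<mu> x r s"
    proof (cases "c r = c s")
      case False
      then show ?thesis using gx by (simp add: BD_def blkdiag_def pull_def)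
    next
      case True
      let ?P = "block_part b (b (\<mu> s)) op_one"
      have P: "?P \<in> A" using A(1) B.block_part_C0[OF B.op_one_BD] by blast
      have "(g x \<odot>\<^sub>o pull c \<mu> ?P) r s = (\<Sum>t\<in>{s}. g x r t * pull c \<mu> ?P t s)"
        by (rule op_mult_finite) (auto simp: pull_def block_part_def op_one_def dest: inj_block)
      then have "g x r s = (g x \<odot>\<^sub>o pull c \<mu> ?P) r s"
        by (simp add: pull_def block_part_def op_one_def)
      also have "g x \<odot>\<^sub>o pull c \<mu> ?P = g (x \<odot>\<^sub>o ?P)"
        using g x P by (simp add: star_hom_def part)
      also have "\<dots> = pull c \<mu> (block_part b (b (\<mu> s)) x)"
        by (simp add: B.op_mult_block_part_one[OF bx] part)
      also have "\<dots> r s = pull c \<mu> x r s"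
        using same_block[OF True] by (simp add: pull_def block_part_def)
      finally show ?thesis .
    qed
  qed
qed

text \<open>
  The image of a block projection acts as the identity on every block of \<open>c\<close> lying over it, so each
  single block of \<open>C0 c\<close> is reached.
\<close>

lemma nondegenerate_pull:
  assumes f: "\<And>a. a \<in> C0 b \<Longrightarrow> f a = pull c \<mu> a"
  shows "nondegenerate_hom (C0 b) (C0 c) f"
  unfolding nondegenerate_hom_def C.multipliers_C0
proof (intro conjI subsetI)
  show "star_hom (C0 b) (BD c) f"
    by (rule star_hom_pull_on[OF B.star_closed_C0 B.C0_sub_BD f])
  fix x assume x: "x \<in> C0 c"
  let ?S = "{f a \<odot>\<^sub>o y |a y. a \<in> C0 b \<and> y \<in> C0 c}"
  have "block_part c l x \<in> cspan ?S" for l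
  proof -
    \<comment> \<open>for an empty block \<open>l\<close> the label \<open>k\<close> is arbitrary, and the block part is zero\<close>
    define k where "k = b (\<mu> (SOME r. c r = l))"
    have k: "b (\<mu> r) = k" if "c r = l" for r
      unfolding k_def using that by (intro same_block) (metis (mono_tags) someI)
    let ?P = "block_part b k op_one"
    have P: "?P \<in> C0 b" using B.block_part_C0[OF B.op_one_BD] .
    have "pull c \<mu> ?P \<odot>\<^sub>o block_part c l x = block_part c l x"
    proof (intro ext)
      fix r s
      have "(pull c \<mu> ?P \<odot>\<^sub>o block_part c l x) r s = (\<Sum>t\<in>{r}. pull c \<mu> ?P r t * block_part c l x t s)"
        by (rule op_mult_finite) (auto simp: pull_def block_part_def op_one_def dest: inj_block)
      then show "(pull c \<mu> ?P \<odot>\<^sub>o block_part c l x) r s = block_part c l x r s"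
        using k by (auto simp: pull_def block_part_def op_one_def)
    qed
    then have "f ?P \<odot>\<^sub>o block_part c l x = block_part c l x"
      using f[OF P] by simp
    moreover have "block_part c l x \<in> C0 c"
      using x by (intro C.block_part_C0) (simp add: C0_def)
    ultimately show ?thesis
      using P by (intro cspan_base CollectI exI[of _ ?P] exI[of _ "block_part c l x"]) simp
  qed
  then show "x \<in> norm_closure (cspan ?S)"
    by (rule C.C0_approx[OF x])
qed

lemma mult_ext_pull:
  assumes f: "\<And>a. a \<in> C0 b \<Longrightarrow> f a = pull c \<mu> a" and x: "x \<in> BD b"
  shows "mult_ext (C0 b) (C0 c) f x = pull c \<mu> x"
proof -
  have "mult_ext (C0 b) (C0 c) f = restrict (pull c \<mu>) (BD b)"
    unfolding mult_ext_def B.multipliers_C0 C.multipliers_C0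
  proof (rule the_equality)
    show "restrict (pull c \<mu>) (BD b) \<in> extensional (BD b) \<and>
        star_hom (BD b) (BD c) (restrict (pull c \<mu>) (BD b)) \<and>
        (\<forall>a\<in>C0 b. restrict (pull c \<mu>) (BD b) a = f a)"
      using f B.C0_sub_BD by (auto intro!: star_hom_pull_on[OF B.star_closed_BD])
  next
    fix g assume g: "g \<in> extensional (BD b) \<and> star_hom (BD b) (BD c) g \<and> (\<forall>a\<in>C0 b. g a = f a)"
    show "g = restrict (pull c \<mu>) (BD b)"
    proof (rule extensionalityI[of _ "BD b"])
      fix y assume y: "y \<in> BD b"
      have "g y = pull c \<mu> y"
        using g f B.unit_op_C0
        by (intro star_hom_determined[OF B.C0_sub_BD order_refl B.star_closed_BD _ _ y]) auto
      then show "g y = restrict (pull c \<mu>) (BD b) y" using y by simp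
    qed (use g in auto)
  qed
  then show ?thesis using x by simp
qed

end

lemma block_map_id:
  assumes "block_structure b"
  shows "block_map b b (\<lambda>x. x)"
proof -
  interpret block_structure b by fact
  show ?thesis by unfold_locales (simp add: bij_betw_def)
qed

lemma pull_id: "T \<in> C0 b \<Longrightarrow> T = pull b (\<lambda>x. x) T"
  by (auto simp: C0_def BD_def blkdiag_def pull_def fun_eq_iff)

text \<open>
  The tensor product of two induced homomorphisms is induced by the product map.
\<close>

locale two_block_maps = L: block_map b c \<mu> + R: block_map b' c' \<nu>
  for b :: "'i \<Rightarrow> 'k" and c :: "'j \<Rightarrow> 'l" and \<mu> and b' :: "'i1 \<Rightarrow> 'k1" and c' :: "'j1 \<Rightarrow> 'l1" and \<nu>
begin

sublocale S: two_block_structures b b' ..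
sublocale T: two_block_structures c c' ..

sublocale M: block_map "map_prod b b'" "map_prod c c'" "map_prod \<mu> \<nu>"
proof
  fix z :: "'j \<times> 'j1"
  obtain r s where z: "z = (r, s)" by (cases z)
  have "bij_betw (map_prod \<mu> \<nu>) (fib c (c r) \<times> fib c' (c' s))
      (fib b (b (\<mu> r)) \<times> fib b' (b' (\<nu> s)))"
    by (rule bij_betw_map_prod[OF L.bij_fib R.bij_fib])
  then show "bij_betw (map_prod \<mu> \<nu>) (fib (map_prod c c') (map_prod c c' z))
      (fib (map_prod b b') (map_prod b b' (map_prod \<mu> \<nu> z)))"
    by (simp add: z S.fib_prod T.fib_prod)
qed

lemma hom_tensor_pull:
  assumes f: "\<And>a. a \<in> C0 b \<Longrightarrow> f a = pull c \<mu> a" and h: "\<And>a. a \<in> C0 b' \<Longrightarrow> h a = pull c' \<nu> a"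
    and x: "x \<in> C0 (map_prod b b')"
  shows "hom_tensor (C0 b) (C0 b') (C0 c) (C0 c') f h x = pull (map_prod c c') (map_prod \<mu> \<nu>) x"
proof -
  let ?p = "pull (map_prod c c') (map_prod \<mu> \<nu>)" and ?A = "C0 (map_prod b b')"
  have "hom_tensor (C0 b) (C0 b') (C0 c) (C0 c') f h = restrict ?p ?A"
    unfolding hom_tensor_def S.alg_tensor_C0 T.alg_tensor_C0 T.P.multipliers_C0
  proof (rule the_equality)
    show "restrict ?p ?A \<in> extensional ?A \<and> star_hom ?A (BD (map_prod c c')) (restrict ?p ?A) \<and>
        (\<forall>a\<in>C0 b. \<forall>d\<in>C0 b'. restrict ?p ?A (a \<otimes>\<^sub>o d) = f a \<otimes>\<^sub>o h d)"
      using f h S.tensor_C0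
      by (auto simp: pull_tensor intro!: M.star_hom_pull_on[OF S.P.star_closed_C0 S.P.C0_sub_BD])
  next
    fix g assume g: "g \<in> extensional ?A \<and> star_hom ?A (BD (map_prod c c')) g \<and>
        (\<forall>a\<in>C0 b. \<forall>d\<in>C0 b'. g (a \<otimes>\<^sub>o d) = f a \<otimes>\<^sub>o h d)"
    show "g = restrict ?p ?A"
    proof (rule extensionalityI[of _ ?A])
      fix y assume y: "y \<in> ?A"
      have "g (unit_op z w) = ?p (unit_op z w)" if zw: "map_prod b b' z = map_prod b b' w" for z w
      proof -
        obtain i k j l where z: "z = (i, k)" "w = (j, l)" by (metis prod.exhaust)
        then have "unit_op i j \<in> C0 b" "unit_op k l \<in> C0 b'"
          using zw by (auto intro: L.B.unit_op_C0 R.B.unit_op_C0)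
        then have "g (unit_op i j \<otimes>\<^sub>o unit_op k l) = ?p (unit_op i j \<otimes>\<^sub>o unit_op k l)"
          using g f h by (simp add: pull_tensor)
        then show ?thesis by (simp only: z unit_op_tensor)
      qed
      then have "g y = ?p y"
        by (rule M.star_hom_determined[OF order_refl S.P.C0_sub_BD S.P.star_closed_C0
              conjunct1[OF conjunct2[OF g]] _ y])
      then show "g y = restrict ?p ?A y" using y by simp
    qed (use g in auto)
  qed
  then show ?thesis using x by simp
qed

lemma mult_ext_hom_tensor:
  assumes f: "\<And>a. a \<in> C0 b \<Longrightarrow> f a = pull c \<mu> a" and h: "\<And>a. a \<in> C0 b' \<Longrightarrow> h a = pull c' \<nu> a"
    and x: "x \<in> BD (map_prod b b')"
  shows "mult_ext (C0 b \<otimes>\<^sub>m C0 b') (C0 c \<otimes>\<^sub>m C0 c') (hom_tensor (C0 b) (C0 b') (C0 c) (C0 c') f h) x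
    = pull (map_prod c c') (map_prod \<mu> \<nu>) x"
  unfolding S.alg_tensor_C0 T.alg_tensor_C0
  by (rule M.mult_ext_pull[OF hom_tensor_pull[OF f h] x])

end

section \<open>The product of basis indices\<close>

definition bmul :: "bidx \<Rightarrow> bidx \<Rightarrow> bidx" where
  "bmul p q = bix (blk p * blk q) (blk q * (pos p - 1) + pos q)"

lemma blk_bmul [simp]: "blk (bmul p q) = blk p * blk q"
  and pos_bmul: "pos (bmul p q) = blk q * (pos p - 1) + pos q"
  using digits_le[OF pos_bounds(1)[of p] pos_bounds(2)[of p] pos_bounds(1)[of q] pos_bounds(2)[of q]]
  by (simp_all add: bmul_def)

text \<open>
  Both sides list the triples of positions in the same lexicographic order.
\<close>

lemma bmul_assoc: "bmul (bmul p q) r = bmul p (bmul q r)"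
proof -
  have "blk r * (blk q * (pos p - 1) + pos q - 1) + pos r
      = blk q * blk r * (pos p - 1) + (blk r * (pos q - 1) + pos r)"
    using pos_bounds(1)[of q] by (cases "pos q") (simp_all add: algebra_simps)
  then show ?thesis by (simp add: bidx_eq_iff pos_bmul)
qed

lemma bmul_cancel:
  assumes "bmul p q = bmul p' q'" "blk p = blk p'" "blk q = blk q'"
  shows "p = p'" "q = q'"
proof -
  have "blk q * (pos p - 1) + pos q = blk q * (pos p' - 1) + pos q'"
    using arg_cong[OF assms(1), of pos] assms(2,3) by (simp add: pos_bmul)
  then have "pos p = pos p' \<and> pos q = pos q'"
    using digits_eq_iff[of "pos p" "pos p'" "pos q" "blk q" "pos q'"] pos_bounds assms(3) by metis
  then show "p = p'" "q = q'" using assms by (simp_all add: bidx_eq_iff)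
qed

text \<open>
  Division with remainder, after shifting positions so that they start from zero.
\<close>

lemma bmul_factor:
  assumes "blk x = n * m"
  obtains p q where "blk p = n" "blk q = m" "bmul p q = x"
proof -
  define k where "k = pos x - 1"
  have k: "pos x = k + 1" "k < n * m" using pos_bounds[of x] assms by (auto simp: k_def)
  then have m: "0 < m" "k div m < n" by (auto simp: less_mult_imp_div_less intro: Nat.gr0I)
  let ?p = "bix n (k div m + 1)" and ?q = "bix m (k mod m + 1)"
  have "blk ?p = n" "pos ?p = k div m + 1" "blk ?q = m" "pos ?q = k mod m + 1"
    using m by (simp_all add: Suc_leI)
  then show thesis
    using k assms by (intro that[of ?p ?q]) (simp_all add: bidx_eq_iff[of "bmul _ _"] pos_bmul)
qed

abbreviation blk2 :: "bidx \<times> bidx \<Rightarrow> nat \<times> nat" where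
  "blk2 \<equiv> map_prod blk blk"

abbreviation bmul2 :: "bidx \<times> bidx \<Rightarrow> bidx" where
  "bmul2 \<equiv> \<lambda>(p, q). bmul p q"

interpretation blk: block_structure blk
proof
  fix n
  have "x \<in> bix n ` {1..n}" if "blk x = n" for x
    using pos_bounds[of x] by (intro image_eqI[of _ _ "pos x"]) (auto simp: that[symmetric])
  then have "fib blk n \<subseteq> bix n ` {1..n}"
    by (auto simp: fib_def)
  then show "finite (fib blk n)" by (rule finite_subset) simp
qed

interpretation blk2: two_block_structures blk blk ..

interpretation bmul: block_map blk blk2 bmul2
proof
  fix z :: "bidx \<times> bidx"
  obtain p q where z: "z = (p, q)" by (cases z)
  have "inj_on bmul2 (fib blk2 (blk p, blk q))"
    by (auto simp: inj_on_def fib_def dest: bmul_cancel)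
  moreover have "x \<in> bmul2 ` fib blk2 (blk p, blk q)" if bx: "blk x = blk p * blk q" for x
  proof -
    obtain p' q' where "blk p' = blk p" "blk q' = blk q" "bmul p' q' = x"
      using bmul_factor[OF bx] by blast
    then show ?thesis by (intro image_eqI[of _ _ "(p', q')"]) (auto simp: fib_def)
  qed
  ultimately show "bij_betw bmul2 (fib blk2 (blk2 z)) (fib blk (blk (bmul2 z)))"
    unfolding bij_betw_def by (auto simp: z fib_def)
qed

lemma Delta_phi_eq: "Delta_phi x = pull blk2 bmul2 x"
  by (auto simp: Delta_phi_def phi_def pull_def bmul_def fun_eq_iff)

lemma Mstar_eq: "Mstar = C0 blk"
proof -
  have eq: "(\<forall>\<epsilon>>0. finite {n. opnorm (block n T) > \<epsilon>}) \<longleftrightarrow>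
      (\<forall>\<epsilon>>0. finite {n. \<not> local_bound (fib blk n) T \<epsilon>})" if T: "T \<in> BD blk" for T
  proof -
    have block_eq: "block n T = block_part blk n T" for n
      by (simp add: block_def block_part_def)
    have 1: "{n. opnorm (block n T) > e} \<subseteq> {n. \<not> local_bound (fib blk n) T e}" if "e > 0" for e
    proof -
      have "opnorm (block n T) \<le> e" if "local_bound (fib blk n) T e" for n
        unfolding block_eq using that \<open>e > 0\<close> by (intro opnorm_le) (simp add: blk.op_bound_block_part_iff)
      then show ?thesis by force
    qed
    have 2: "{n. \<not> local_bound (fib blk n) T e} \<subseteq> {n. opnorm (block n T) > e / 2}" if "e > 0" for e
    proof -
      have "local_bound (fib blk n) T e" if "opnorm (block n T) \<le> e / 2" for n
      proof -
        have "bounded_op (block n T)"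
          using blk.block_part_C0[OF T, of n] unfolding block_eq by (simp add: C0_def BD_def)
        moreover have "opnorm (block n T) < e" using that \<open>e > 0\<close> by simp
        ultimately have "op_bound (block n T) e" by (rule opnorm_less)
        then show ?thesis unfolding block_eq blk.op_bound_block_part_iff by simp
      qed
      then show ?thesis by force
    qed
    show ?thesis
      using 1 2 by (meson finite_subset half_gt_zero)
  qed
  then show ?thesis
    by (auto simp: Mstar_def C0_def BD_def blkdiag_def)
qed

section \<open>Relations as operators\<close>

text \<open>
  Zero-one matrices; \<open>R\<close> and all its legs are of this form, and their products are computed by
  composing relations.
\<close>

definition rel_op :: "('i \<Rightarrow> 'i \<Rightarrow> bool) \<Rightarrow> 'i oper" where
  "rel_op Q = (\<lambda>r s. if Q r s then 1 else 0)"

lemma rel_op_mult_left: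
  assumes "Q r t" "\<And>t'. Q r t' \<Longrightarrow> t' = t"
  shows "(rel_op Q \<odot>\<^sub>o X) r s = X t s"
proof -
  have "\<not> Q r l" if "l \<noteq> t" for l
    using assms(2) that by blast
  then have "(rel_op Q \<odot>\<^sub>o X) r s = (\<Sum>l\<in>{t}. rel_op Q r l * X l s)"
    by (intro op_mult_finite) (simp_all add: rel_op_def)
  then show ?thesis using assms(1) by (simp add: rel_op_def)
qed

lemma rel_op_mult_right:
  assumes "Q t s" "\<And>t'. Q t' s \<Longrightarrow> t' = t"
  shows "(X \<odot>\<^sub>o rel_op Q) r s = X r t"
proof -
  have "\<not> Q l s" if "l \<noteq> t" for l
    using assms(2) that by blast
  then have "(X \<odot>\<^sub>o rel_op Q) r s = (\<Sum>l\<in>{t}. X r l * rel_op Q l s)"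
    by (intro op_mult_finite) (simp_all add: rel_op_def)
  then show ?thesis using assms(1) by (simp add: rel_op_def)
qed

lemma adj_rel_op: "adj (rel_op Q) = rel_op (\<lambda>r s. Q s r)"
  by (simp add: adj_def rel_op_def fun_eq_iff)

lemma rel_op_eq_one: "rel_op (=) = op_one"
  by (simp add: rel_op_def op_one_def)

text \<open>
  Since \<open>Q\<close> is single-valued, at most one intermediate index contributes, so the entry is again zero or
  one.
\<close>

lemma rel_op_mult:
  assumes "\<And>r s t. Q r s \<Longrightarrow> Q r t \<Longrightarrow> s = t"
  shows "rel_op Q \<odot>\<^sub>o rel_op Q' = rel_op (\<lambda>r s. \<exists>t. Q r t \<and> Q' t s)"
proof (intro ext)
  fix r s
  show "(rel_op Q \<odot>\<^sub>o rel_op Q') r s = rel_op (\<lambda>r s. \<exists>t. Q r t \<and> Q' t s) r s"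
  proof (cases "\<exists>t. Q r t")
    case True
    then obtain t where t: "Q r t" by blast
    have u: "t' = t" if "Q r t'" for t' using assms[OF that t] .
    have "(\<exists>t. Q r t \<and> Q' t s) \<longleftrightarrow> Q' t s" using t u by blast
    have "(rel_op Q \<odot>\<^sub>o rel_op Q') r s = rel_op Q' t s"
      by (rule rel_op_mult_left[where Q = Q and t = t]) (rule t, rule u)
    then show ?thesis using \<open>(\<exists>t. Q r t \<and> Q' t s) \<longleftrightarrow> Q' t s\<close> by (simp add: rel_op_def)
  next
    case False
    then have "(rel_op Q \<odot>\<^sub>o rel_op Q') r s = (\<Sum>l\<in>{}. rel_op Q r l * rel_op Q' l s)"
      by (intro op_mult_finite) (auto simp: rel_op_def)
    then show ?thesis using False by (simp add: rel_op_def)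
  qed
qed

lemma local_bound_perm:
  assumes "finite B" "inj_on \<tau> B" "\<tau> ` B \<subseteq> B"
    and U: "\<And>i j. i \<in> B \<Longrightarrow> j \<in> B \<Longrightarrow> U i j = (if j = \<tau> i then 1 else 0)"
  shows "local_bound B U 1"
  unfolding local_bound_def
proof
  fix v
  have "op_app B U v i = v (\<tau> i)" if "i \<in> B" for i
  proof -
    have "op_app B U v i = (\<Sum>j\<in>B. if j = \<tau> i then v j else 0)"
      unfolding op_app_def using that by (intro sum.cong) (simp_all add: U)
    then show ?thesis using assms(1,3) that by auto
  qed
  then have "(vnorm B (op_app B U v))\<^sup>2 = (\<Sum>i\<in>B. (cmod (v (\<tau> i)))\<^sup>2)"
    by (simp add: vnorm_sq)
  also have "\<dots> = (\<Sum>i\<in>\<tau> ` B. (cmod (v i))\<^sup>2)"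
    by (simp add: sum.reindex[OF assms(2)])
  also have "\<tau> ` B = B" by (rule endo_inj_surj[OF assms(1,3,2)])
  finally have "(vnorm B (op_app B U v))\<^sup>2 = (vnorm B v)\<^sup>2" by (simp add: vnorm_sq)
  then show "vnorm B (op_app B U v) \<le> 1 * vnorm B v" by simp
qed

section \<open>The R-matrix\<close>

text \<open>
  The relation of which \<open>R\<close> is the matrix.  Written through \<open>bmul\<close> it replaces the equation
  \<open>m (i - 1) + j = n (b - 1) + a\<close> that defines \<open>under_pair\<close>: its two sides are the positions of
  \<open>bmul p' q'\<close> and \<open>bmul q p\<close>.
\<close>

definition swapped :: "bidx \<times> bidx \<Rightarrow> bidx \<times> bidx \<Rightarrow> bool" where
  "swapped = (\<lambda>(p, q) (p', q'). blk p = blk p' \<and> blk q = blk q' \<and> bmul q p = bmul p' q')"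

lemma swappedI: "blk p = blk p' \<Longrightarrow> blk q = blk q' \<Longrightarrow> bmul q p = bmul p' q' \<Longrightarrow> swapped (p, q) (p', q')"
  by (simp add: swapped_def)

lemma R_op_eq: "R_op = rel_op swapped"
proof -
  have "(pos p, pos q) = under_pair (blk p') (blk q') (pos p') (pos q') \<longleftrightarrow> bmul q p = bmul p' q'"
    if eq: "blk p = blk p'" "blk q = blk q'" for p q p' q'
  proof -
    let ?P = "\<lambda>(a, b). a \<in> {1..blk p'} \<and> b \<in> {1..blk q'} \<and>
        blk q' * (pos p' - 1) + pos q' = blk p' * (b - 1) + a"
    have ex: "\<exists>!z. ?P z"
      using under_pair_unique[of "pos p'" "blk p'" "pos q'" "blk q'"] pos_bounds by simp
    have "(pos p, pos q) = under_pair (blk p') (blk q') (pos p') (pos q') \<longleftrightarrow> ?P (pos p, pos q)"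
    proof
      show "?P (pos p, pos q)" if "(pos p, pos q) = under_pair (blk p') (blk q') (pos p') (pos q')"
        unfolding that under_pair_def by (rule theI'[OF ex])
      show "(pos p, pos q) = under_pair (blk p') (blk q') (pos p') (pos q')" if "?P (pos p, pos q)"
        unfolding under_pair_def by (rule the1_equality[OF ex that, symmetric])
    qed
    also have "\<dots> \<longleftrightarrow> bmul q p = bmul p' q'"
      using pos_bounds[of p] pos_bounds[of q] eq
      by (auto simp: bidx_eq_iff[of "bmul _ _"] pos_bmul)
    finally show ?thesis .
  qed
  then show ?thesis
    by (auto simp: R_op_def rel_op_def swapped_def fun_eq_iff)
qed

lemma swapped_right_unique: "swapped r s \<Longrightarrow> swapped r t \<Longrightarrow> s = t"
  by (cases r; cases s; cases t) (auto simp: swapped_def dest: bmul_cancel)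

text \<open>
  Exchanging the factors reverses the relation; this is the source of \<open>R \<tau>(R) = I\<close>.
\<close>

lemma swapped_flip: "swapped (prod.swap r) (prod.swap s) \<longleftrightarrow> swapped s r"
  by (cases r; cases s) (auto simp: swapped_def)

lemma swapped_left_unique: "swapped s r \<Longrightarrow> swapped t r \<Longrightarrow> s = t"
  by (metis swapped_right_unique swapped_flip swap_swap)

lemma swapped_total: "\<exists>s. swapped r s"
proof -
  obtain p q where r: "r = (p, q)" by (cases r)
  obtain p' q' where "blk p' = blk p" "blk q' = blk q" "bmul p' q' = bmul q p"
    by (rule bmul_factor[of "bmul q p" "blk p" "blk q"]) (auto simp: mult.commute)
  then show ?thesis unfolding r by (intro exI[of _ "(p', q')"] swappedI) simp_all
qed

lemma swapped_surj: "\<exists>s. swapped s r"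
  using swapped_total[of "prod.swap r"] by (metis swapped_flip swap_swap)

lemma swapped_blk2: "swapped r s \<Longrightarrow> blk2 r = blk2 s"
  by (auto simp: swapped_def split: prod.splits)

lemma R_op_BD: "R_op \<in> BD blk2"
proof -
  obtain \<tau> where \<tau>: "\<And>r. swapped r (\<tau> r)" using swapped_total by metis
  then have iff: "swapped r s \<longleftrightarrow> s = \<tau> r" for r s using swapped_right_unique by blast
  have "local_bound (fib blk2 z) R_op 1" for z
  proof (rule local_bound_perm)
    show "finite (fib blk2 z)" by (rule blk2.P.finite_fib)
    show "inj_on \<tau> (fib blk2 z)" using \<tau> swapped_left_unique by (metis inj_onI)
    show "\<tau> ` fib blk2 z \<subseteq> fib blk2 z" using swapped_blk2[OF \<tau>] by (auto simp: fib_def)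
    show "R_op r s = (if s = \<tau> r then 1 else 0)" for r s by (simp add: R_op_eq rel_op_def iff)
  qed
  moreover have "blkdiag blk2 R_op"
    using swapped_blk2 by (auto simp: blkdiag_def R_op_eq rel_op_def)
  ultimately show ?thesis by (auto simp: blk2.P.BD_iff intro!: exI[of _ 1])
qed

lemma unitary_R_op: "unitary_op R_op"
proof -
  have "(\<lambda>r s. \<exists>t. swapped r t \<and> swapped s t) = (=)"
    using swapped_total swapped_left_unique by (intro ext) metis
  then have "rel_op swapped \<odot>\<^sub>o rel_op (\<lambda>r s. swapped s r) = rel_op (=)"
    by (simp only: rel_op_mult[OF swapped_right_unique])
  moreover have "(\<lambda>r s. \<exists>t. swapped t r \<and> swapped t s) = (=)"
    using swapped_surj swapped_right_unique by (intro ext) metis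
  then have "rel_op (\<lambda>r s. swapped s r) \<odot>\<^sub>o rel_op swapped = rel_op (=)"
    by (simp only: rel_op_mult[OF swapped_left_unique])
  ultimately show ?thesis by (simp add: unitary_op_def R_op_eq adj_rel_op rel_op_eq_one)
qed

lemma op_flip_swap: "op_flip X r s = X (prod.swap r) (prod.swap s)"
  by (cases r; cases s) (simp add: op_flip_def)

lemma op_flip_R_op: "op_flip R_op = adj R_op"
  by (intro ext) (simp add: op_flip_swap R_op_eq adj_rel_op, simp add: rel_op_def swapped_flip)

text \<open>
  The left side has entry \<open>\<Delta> x t u\<close> at \<open>(r, s)\<close>, where \<open>t\<close> and \<open>u\<close> are the partners of \<open>r\<close> and \<open>s\<close>.  Being
  partners means having the same product after a flip, and within a block \<open>\<Delta> x\<close> depends on its indices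
  only through their products.
\<close>

lemma R_op_conj: "R_op \<odot>\<^sub>o Delta_phi x \<odot>\<^sub>o adj R_op = op_flip (Delta_phi x)"
proof (intro ext)
  fix r s
  obtain t u where t: "swapped r t" and u: "swapped s u" using swapped_total by metis
  have "(R_op \<odot>\<^sub>o Delta_phi x \<odot>\<^sub>o adj R_op) r s = (R_op \<odot>\<^sub>o Delta_phi x) r u"
    unfolding R_op_eq adj_rel_op by (rule rel_op_mult_right) (use u swapped_right_unique in blast)+
  also have "\<dots> = Delta_phi x t u"
    unfolding R_op_eq by (rule rel_op_mult_left) (use t swapped_right_unique in blast)+
  also have "\<dots> = op_flip (Delta_phi x) r s"
    using t u by (auto simp: op_flip_swap Delta_phi_eq pull_def swapped_def split: prod.splits)
  finally show "(R_op \<odot>\<^sub>o Delta_phi x \<odot>\<^sub>o adj R_op) r s = op_flip (Delta_phi x) r s" .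
qed

lemma comult_id_eq:
  assumes X: "X \<in> BD blk2"
  shows "comult_id Mstar Delta_phi X = (\<lambda>(i, j, k) (i', j', k').
    if blk i = blk i' \<and> blk j = blk j' \<and> blk k = blk k' then X (bmul i j, k) (bmul i' j', k') else 0)"
proof -
  interpret two_block_maps blk blk2 bmul2 blk blk "\<lambda>x. x"
    by (intro two_block_maps.intro bmul.block_map_axioms block_map_id blk.block_structure_axioms)
  have "mult_ext (Mstar \<otimes>\<^sub>m Mstar) ((Mstar \<otimes>\<^sub>m Mstar) \<otimes>\<^sub>m Mstar)
      (hom_tensor Mstar Mstar (Mstar \<otimes>\<^sub>m Mstar) Mstar Delta_phi (\<lambda>a. a)) X
    = pull (map_prod blk2 blk) (map_prod bmul2 (\<lambda>x. x)) X"
    unfolding Mstar_eq blk2.alg_tensor_C0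
    by (rule mult_ext_hom_tensor[unfolded blk2.alg_tensor_C0, OF Delta_phi_eq pull_id X])
  then show ?thesis
    unfolding comult_id_def by (auto simp: reassoc_def pull_def fun_eq_iff)
qed

lemma id_comult_eq:
  assumes X: "X \<in> BD blk2"
  shows "id_comult Mstar Delta_phi X = (\<lambda>(i, j, k) (i', j', k').
    if blk i = blk i' \<and> blk j = blk j' \<and> blk k = blk k' then X (i, bmul j k) (i', bmul j' k') else 0)"
proof -
  interpret two_block_maps blk blk "\<lambda>x. x" blk blk2 bmul2
    by (intro two_block_maps.intro bmul.block_map_axioms block_map_id blk.block_structure_axioms)
  have "mult_ext (Mstar \<otimes>\<^sub>m Mstar) (Mstar \<otimes>\<^sub>m (Mstar \<otimes>\<^sub>m Mstar))
      (hom_tensor Mstar Mstar Mstar (Mstar \<otimes>\<^sub>m Mstar) (\<lambda>a. a) Delta_phi) X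
    = pull (map_prod blk blk2) (map_prod (\<lambda>x. x) bmul2) X"
    unfolding Mstar_eq blk2.alg_tensor_C0
    by (rule mult_ext_hom_tensor[unfolded blk2.alg_tensor_C0, OF pull_id Delta_phi_eq X])
  then show ?thesis
    unfolding id_comult_def by (auto simp: pull_def fun_eq_iff)
qed

lemma cstar_bialgebra_Mstar: "cstar_bialgebra Mstar Delta_phi"
  unfolding cstar_bialgebra_def
proof (intro conjI ballI)
  show "cstar_algebra Mstar" unfolding Mstar_eq by (rule blk.cstar_algebra_C0)
  show "nondegenerate_hom Mstar (Mstar \<otimes>\<^sub>m Mstar) Delta_phi"
    unfolding Mstar_eq blk2.alg_tensor_C0 by (rule bmul.nondegenerate_pull[OF Delta_phi_eq])
  fix x assume "x \<in> Mstar"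
  then have "Delta_phi x \<in> BD blk2"
    unfolding Delta_phi_eq Mstar_eq using blk.C0_sub_BD by (intro bmul.pull_BD) auto
  then show "comult_id Mstar Delta_phi (Delta_phi x) = id_comult Mstar Delta_phi (Delta_phi x)"
    by (auto simp: comult_id_eq id_comult_eq Delta_phi_eq pull_def bmul_assoc fun_eq_iff)
qed

lemma universal_R_matrix_R_op: "universal_R_matrix Mstar Delta_phi R_op"
  unfolding universal_R_matrix_def Mstar_eq blk2.alg_tensor_C0 blk2.P.multipliers_C0
  by (simp add: R_op_BD unitary_R_op R_op_conj)

text \<open>
  If \<open>k i = i' c\<close> and \<open>c j = j' k'\<close>, then associativity gives \<open>k (i j) = i' (c j) = (i' j') k'\<close>.
  Conversely, factor \<open>k i = a c\<close> with factors in the blocks of \<open>i\<close> and \<open>k\<close>; then \<open>a (c j) = i' (j' k')\<close>,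
  and cancellation yields \<open>a = i'\<close> and \<open>c j = j' k'\<close>.
\<close>

lemma hexagon_left:
  "blk i = blk i' \<and> blk j = blk j' \<and> blk k = blk k' \<and> bmul k (bmul i j) = bmul (bmul i' j') k' \<longleftrightarrow>
    (\<exists>c. swapped (i, k) (i', c) \<and> swapped (j, c) (j', k'))"
proof
  assume L: "blk i = blk i' \<and> blk j = blk j' \<and> blk k = blk k' \<and> bmul k (bmul i j) = bmul (bmul i' j') k'"
  obtain a c where ac: "blk a = blk i" "blk c = blk k" "bmul a c = bmul k i"
    by (rule bmul_factor[of "bmul k i" "blk i" "blk k"]) (auto simp: mult.commute)
  have "bmul a (bmul c j) = bmul i' (bmul j' k')"
    using L ac(3) by (metis bmul_assoc)
  then have "a = i'" "bmul c j = bmul j' k'"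
    using bmul_cancel[of a "bmul c j" i' "bmul j' k'"] L ac by (simp_all add: mult.commute)
  then show "\<exists>c. swapped (i, k) (i', c) \<and> swapped (j, c) (j', k')"
    using L ac by (intro exI[of _ c]) (auto intro!: swappedI)
next
  assume "\<exists>c. swapped (i, k) (i', c) \<and> swapped (j, c) (j', k')"
  then obtain c where c: "blk i = blk i'" "blk k = blk c" "bmul k i = bmul i' c"
    "blk j = blk j'" "blk c = blk k'" "bmul c j = bmul j' k'"
    by (auto simp: swapped_def)
  then have "bmul k (bmul i j) = bmul (bmul i' j') k'" by (metis bmul_assoc)
  with c show "blk i = blk i' \<and> blk j = blk j' \<and> blk k = blk k' \<and> bmul k (bmul i j) = bmul (bmul i' j') k'"
    by simp
qed

text \<open>
  The same factorisation \<open>k i = a c\<close> is now used from the right: \<open>(j a) c = (j k) i = (i' j') k'\<close>, so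
  that \<open>c = k'\<close> and \<open>j a = i' j'\<close>.
\<close>

lemma hexagon_right:
  "blk i = blk i' \<and> blk j = blk j' \<and> blk k = blk k' \<and> bmul (bmul j k) i = bmul i' (bmul j' k') \<longleftrightarrow>
    (\<exists>a. swapped (i, k) (a, k') \<and> swapped (a, j) (i', j'))"
proof
  assume L: "blk i = blk i' \<and> blk j = blk j' \<and> blk k = blk k' \<and> bmul (bmul j k) i = bmul i' (bmul j' k')"
  obtain a c where ac: "blk a = blk i" "blk c = blk k" "bmul a c = bmul k i"
    by (rule bmul_factor[of "bmul k i" "blk i" "blk k"]) (auto simp: mult.commute)
  have "bmul (bmul j a) c = bmul (bmul i' j') k'"
    using L ac(3) by (metis bmul_assoc)
  then have "bmul j a = bmul i' j'" "c = k'"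
    using bmul_cancel[of "bmul j a" c "bmul i' j'" k'] L ac by (simp_all add: mult.commute)
  then show "\<exists>a. swapped (i, k) (a, k') \<and> swapped (a, j) (i', j')"
    using L ac by (intro exI[of _ a]) (auto intro!: swappedI)
next
  assume "\<exists>a. swapped (i, k) (a, k') \<and> swapped (a, j) (i', j')"
  then obtain a where c: "blk i = blk a" "blk k = blk k'" "bmul k i = bmul a k'"
    "blk a = blk i'" "blk j = blk j'" "bmul j a = bmul i' j'"
    by (auto simp: swapped_def)
  then have "bmul (bmul j k) i = bmul i' (bmul j' k')" by (metis bmul_assoc)
  with c show "blk i = blk i' \<and> blk j = blk j' \<and> blk k = blk k' \<and> bmul (bmul j k) i = bmul i' (bmul j' k')"
    by simp
qed

lemma leg12_R_op: "leg12 R_op = rel_op (\<lambda>(i, j, k) (i', j', k'). swapped (i, j) (i', j') \<and> k = k')"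
  and leg13_R_op: "leg13 R_op = rel_op (\<lambda>(i, j, k) (i', j', k'). swapped (i, k) (i', k') \<and> j = j')"
  and leg23_R_op: "leg23 R_op = rel_op (\<lambda>(i, j, k) (i', j', k'). swapped (j, k) (j', k') \<and> i = i')"
  by (auto simp: leg12_def leg13_def leg23_def R_op_eq rel_op_def op_one_def fun_eq_iff)

text \<open>
  In both products of legs \<open>R\<^sub>1\<^sub>3\<close> stands on the left, so this computes both.
\<close>

lemma leg13_mult_rel_op:
  "leg13 R_op \<odot>\<^sub>o rel_op Q = rel_op (\<lambda>(i, j, k) s. \<exists>a c. swapped (i, k) (a, c) \<and> Q (a, j, c) s)"
  unfolding leg13_R_op
  by (subst rel_op_mult) (auto simp: fun_eq_iff rel_op_def dest: swapped_right_unique)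

lemma comult_id_R_op: "comult_id Mstar Delta_phi R_op = leg13 R_op \<odot>\<^sub>o leg23 R_op"
proof -
  have "(\<exists>c. swapped (i, k) (i', c) \<and> swapped (j, c) (j', k')) \<longleftrightarrow>
      blk i = blk i' \<and> blk j = blk j' \<and> blk k = blk k' \<and> swapped (bmul i j, k) (bmul i' j', k')"
    for i j k i' j' k'
    unfolding hexagon_left[symmetric] by (auto simp: swapped_def)
  then show ?thesis
    unfolding comult_id_eq[OF R_op_BD] leg23_R_op leg13_mult_rel_op
    by (simp add: R_op_eq rel_op_def fun_eq_iff)
qed

lemma id_comult_R_op: "id_comult Mstar Delta_phi R_op = leg13 R_op \<odot>\<^sub>o leg12 R_op"
proof -
  have "(\<exists>a. swapped (i, k) (a, k') \<and> swapped (a, j) (i', j')) \<longleftrightarrow>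
      blk i = blk i' \<and> blk j = blk j' \<and> blk k = blk k' \<and> swapped (i, bmul j k) (i', bmul j' k')"
    for i j k i' j' k'
    unfolding hexagon_right[symmetric] by (auto simp: swapped_def)
  then show ?thesis
    unfolding id_comult_eq[OF R_op_BD] leg12_R_op leg13_mult_rel_op
    by (simp add: R_op_eq rel_op_def fun_eq_iff)
qed

theorem theorem1p4:
  "universal_R_matrix Mstar Delta_phi R_op \<and> triangular Mstar Delta_phi R_op"
proof
  show "universal_R_matrix Mstar Delta_phi R_op" by (rule universal_R_matrix_R_op)
  have "R_op \<odot>\<^sub>o op_flip R_op = op_one"
    using unitary_R_op by (simp add: op_flip_R_op unitary_op_def)
  then show "triangular Mstar Delta_phi R_op"
    unfolding triangular_def quasi_triangular_def quasi_cocommutative_def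
    using cstar_bialgebra_Mstar universal_R_matrix_R_op comult_id_R_op id_comult_R_op by blast
qed

end
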